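(* Let $f:\mathbb{R}^{n_1\times\cdots\times n_d}\to\mathbb{R}$ be smooth and let $\{\mathcal{X}^{(t)}\}_{t\ge0}\subseteq\mathcal{M}_{\le\mathbf{r}}$ be an infinite sequence generated by the gradient-related approximate projection method (GRAP) described in the context, with parameters $\omega\in(0,1]$, $\rho,a\in(0,1)$, $s_{\min}>0$. Assume $f$ is bounded below by $f^*$. Then $$\lim_{t\to\infty}\|\mathrm{P}_{\mathrm{T}_{\mathcal{X}^{(t)}}\mathcal{M}_{\le\mathbf{r}}}(-\nabla f(\mathcal{X}^{(t)}))\|_{\mathrm F}=0.$$ Moreover, the method returns $\mathcal{X}^{(t)}\in\mathcal{M}_{\le\mathbf{r}}$ satisfying $\|\mathrm{P}_{\mathrm{T}_{\mathcal{X}^{(t)}}\mathcal{M}_{\le\mathbf{r}}}(-\nabla f(\mathcal{X}^{(t)}))\|_{\mathrm F}<\epsilon$ after at most $\left\lceil f(\mathcal{X}^{(0)})/(s_{\min}\,a\,\omega^2\epsilon^2)\right\rceil$ iterations.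
   Context: Tensor notation. $\mathrm{St}(p,n)=\{\mathbf{X}\in\mathbb{R}^{n\times p}:\mathbf{X}^{\mathsf T}\mathbf{X}=\mathbf{I}_p\}$. $\mathbf{X}_{(k)}\in\mathbb{R}^{n_k\times n_{-k}}$, $n_{-k}=\prod_{i\ne k}n_i$, is the mode-$k$ unfolding, $(\mathcal{X}\times_k\mathbf{A})_{(k)}=\mathbf{A}\mathbf{X}_{(k)}$, and $\mathrm{rank}_{\mathrm{tc}}(\mathcal{X})=(\mathrm{rank}\,\mathbf{X}_{(1)},\dots,\mathrm{rank}\,\mathbf{X}_{(d)})$. $\mathbf{r}=(r_1,\dots,r_d)$ is a vector of positive integers with $r_k\le n_k$, and $\mathcal{M}_{\le\mathbf{r}}=\{\mathcal{X}:\mathrm{rank}_{\mathrm{tc}}(\mathcal{X})\le\mathbf{r}\}$ (componentwise). $\mathrm{T}_{\mathcal{X}}\mathcal{M}_{\le\mathbf{r}}$ is the Bouligand tangent cone (limits of $(\mathcal{X}^{(i)}-\mathcal{X})/t^{(i)}$ with $\mathcal{X}^{(i)}\in\mathcal{M}_{\le\mathbf{r}}$, $\mathcal{X}^{(i)}\to\mathcal{X}$, $t^{(i)}>0$, $t^{(i)}\to0$). $\mathrm{P}_{\mathrm{T}_{\mathcal{X}}\mathcal{M}_{\le\mathbf{r}}}(\mathcal{A})$ denotes a (any) minimizer of $\|\mathcal{A}-\mathcal{V}\|_{\mathrm F}$ over $\mathcal{V}\in\mathrm{T}_{\mathcal{X}}\mathcal{M}_{\le\mathbf{r}}$ (its norm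 does not depend on the choice). HOSVD. $\mathrm{P}^{\mathrm{HO}}_{\le\mathbf{r}}(\mathcal{A})=\mathcal{A}\times_{k=1}^d\bar{\mathbf{U}}_k\bar{\mathbf{U}}_k^{\mathsf T}$, where the columns of $\bar{\mathbf{U}}_k\in\mathrm{St}(r_k,n_k)$ are leading $r_k$ left singular vectors of $\mathbf{A}_{(k)}$. Approximate projection. For $\mathcal{X}=\mathcal{G}\times_{k=1}^d\mathbf{U}_k$ with $\mathrm{rank}_{\mathrm{tc}}(\mathcal{X})=\underline{\mathbf{r}}\le\mathbf{r}$, $\mathcal{G}\in\mathbb{R}^{\underline r_1\times\cdots\times\underline r_d}$, $\mathbf{U}_k\in\mathrm{St}(\underline r_k,n_k)$, and (randomly) chosen $\tilde{\mathbf{U}}_{k,1}\in\mathrm{St}(r_k-\underline r_k,n_k)$ with $\mathbf{U}_k^{\mathsf T}\tilde{\mathbf{U}}_{k,1}=0$, put $\tilde{\mathbf{S}}_k=[\mathbf{U}_k\ \tilde{\mathbf{U}}_{k,1}]$ and $$\tilde{\mathrm P}_{\mathrm{T}_{\mathcal{X}}\mathcal{M}_{\le\mathbf{r}}}\mathcal{A}=\mathcal{A}\times_{k=1}^d\mathrm{P}_{\tilde{\mathbf{S}}_k}+\sum_{k=1}^d\mathcal{G}\times_k\Big(\mathrm{P}^\perp_{\tilde{\mathbf{S}}_k}(\mathcal{A}\times_{j\ne k}\mathbf{U}_j^{\mathsf T})_{(k)}\mathbf{G}_{(k)}^\dagger\Big)\times_{j\ne k}\mathbf{U}_j,$$ where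 $\mathrm{P}_{\mathbf{S}}=\mathbf{S}\mathbf{S}^{\mathsf T}$, $\mathrm{P}_{\mathbf{S}}^\perp=\mathbf{I}-\mathbf{S}\mathbf{S}^{\mathsf T}$ and $\dagger$ is the Moore–Penrose pseudoinverse. GRAP. Start from $\mathcal{X}^{(0)}\in\mathcal{M}_{\le\mathbf{r}}$. At iteration $t$: (1) compute $g^{(t)}=\tilde{\mathrm P}_{\mathrm{T}_{\mathcal{X}^{(t)}}\mathcal{M}_{\le\mathbf{r}}}(-\nabla f(\mathcal{X}^{(t)}))$, repeating with other choices of the $\tilde{\mathbf{U}}_{k,1}$ until the angle condition $\langle-\nabla f(\mathcal{X}^{(t)}),g^{(t)}\rangle\ge\omega\|\mathrm{P}_{\mathrm{T}_{\mathcal{X}^{(t)}}\mathcal{M}_{\le\mathbf{r}}}(-\nabla f(\mathcal{X}^{(t)}))\|_{\mathrm F}\|g^{(t)}\|_{\mathrm F}$ holds; (2) given an initial stepsize $s_0^{(t)}>0$, take $s^{(t)}=\rho^l s_0^{(t)}>s_{\min}$ with the smallest integer $l$ such that $f(\mathcal{X}^{(t)})-f(\mathrm{P}^{\mathrm{HO}}_{\le\mathbf{r}}(\mathcal{X}^{(t)}+s^{(t)}g^{(t)}))\ge s^{(t)}a\langle-\nabla f(\mathcal{X}^{(t)}),g^{(t)}\rangle$ (Armijo backtracking; that such a stepsize exists at every iteration is part of the assumption that the sequence is generated by the method); (3) set $\mathcal{X}^{(t+1)}=\mathrm{P}^{\mathrm{HO}}_{\le\mathbf{r}}(\mathcal{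X}^{(t)}+s^{(t)}g^{(t)})$.
   Formalization: The angle condition additionally requires that g=0 be accepted only when the projected gradient is zero (otherwise the method can stall). The iteration bound uses f(X^(0))-f* in place of f(X^(0)); the bound as printed is stated only when f* ≥ 0. *)

theory Defs
  imports "HOL-Analysis.Inner_Product" "Jordan_Normal_Form.DL_Rank"
begin

section \<open>Tensors\<close>

text \<open>
  Core tensors of varying size occur next to the ambient tensors, so tensors of all orders and sizes
  live in a single type: finitely supported real functions on multi-indices, with the Frobenius
  inner product. The space of tensors of size \<open>n\<^sub>1 \<times> \<dots> \<times> n\<^sub>d\<close> is the subspace \<open>tensors n\<close> of those
  supported on the box given by \<open>n = [n\<^sub>1, \<dots>, n\<^sub>d]\<close>. Modes and indices count from 0.
\<close>

typedef tensor = "{X :: nat list \<Rightarrow> real. finite {i. X i \<noteq> 0}}"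
  morphisms entry Tensor
  by (rule exI[of _ "\<lambda>_. 0"]) simp

setup_lifting type_definition_tensor

lemma tensor_eqI: "(\<And>i. entry X i = entry Y i) \<Longrightarrow> X = Y"
  by transfer auto

lemma finite_support [simp]: "finite {i. entry X i \<noteq> 0}"
  by transfer simp

instantiation tensor :: real_vector
begin

lift_definition zero_tensor :: tensor is "\<lambda>_. 0" by simp

lift_definition plus_tensor :: "tensor \<Rightarrow> tensor \<Rightarrow> tensor" is "\<lambda>X Y i. X i + Y i"
  subgoal for X Y by (rule finite_subset[of _ "{i. X i \<noteq> 0} \<union> {i. Y i \<noteq> 0}"]) auto
  done

lift_definition uminus_tensor :: "tensor \<Rightarrow> tensor" is "\<lambda>X i. - X i"
  by simp

lift_definition minus_tensor :: "tensor \<Rightarrow> tensor \<Rightarrow> tensor" is "\<lambda>X Y i. X i - Y i"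
  subgoal for X Y by (rule finite_subset[of _ "{i. X i \<noteq> 0} \<union> {i. Y i \<noteq> 0}"]) auto
  done

lift_definition scaleR_tensor :: "real \<Rightarrow> tensor \<Rightarrow> tensor" is "\<lambda>c X i. c * X i"
  by (rule finite_subset) auto

instance
  by standard (transfer; auto simp: algebra_simps)+

end

instantiation tensor :: real_inner
begin

definition inner_tensor :: "tensor \<Rightarrow> tensor \<Rightarrow> real" where
  "inner_tensor X Y = (\<Sum>i | entry X i \<noteq> 0. entry X i * entry Y i)"

definition norm_tensor :: "tensor \<Rightarrow> real" where
  "norm_tensor X = sqrt (inner X X)"

definition sgn_tensor :: "tensor \<Rightarrow> tensor" where
  "sgn_tensor X = scaleR (inverse (norm X)) X"

definition dist_tensor :: "tensor \<Rightarrow> tensor \<Rightarrow> real" where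
  "dist_tensor X Y = norm (X - Y)"

definition uniformity_tensor :: "(tensor \<times> tensor) filter" where
  "uniformity_tensor = (INF e\<in>{0<..}. principal {(x, y). dist x y < e})"

definition open_tensor :: "tensor set \<Rightarrow> bool" where
  "open_tensor U \<longleftrightarrow> (\<forall>x\<in>U. \<forall>\<^sub>F (x', y) in uniformity. x' = x \<longrightarrow> y \<in> U)"

lemma inner_tensor_superset:
  assumes "finite A" and "{i. entry X i \<noteq> 0} \<subseteq> A"
  shows "inner X Y = (\<Sum>i\<in>A. entry X i * entry Y i)"
  unfolding inner_tensor_def by (rule sum.mono_neutral_left) (use assms in auto)

instance
proof
  fix X Y Z :: tensor and c :: real
  let ?A = "{i. entry X i \<noteq> 0} \<union> {i. entry Y i \<noteq> 0}"
  have fin: "finite ?A" by simp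
  show "inner X Y = inner Y X"
    by (simp add: inner_tensor_superset[OF fin] mult.commute)
  have "inner (X + Y) Z = (\<Sum>i\<in>?A. entry (X + Y) i * entry Z i)"
    by (rule inner_tensor_superset[OF fin]) (auto simp: plus_tensor.rep_eq)
  also have "\<dots> = inner X Z + inner Y Z"
    by (simp add: inner_tensor_superset[OF fin] plus_tensor.rep_eq algebra_simps sum.distrib)
  finally show "inner (X + Y) Z = inner X Z + inner Y Z" .
  have "inner (scaleR c X) Y = (\<Sum>i | entry X i \<noteq> 0. entry (scaleR c X) i * entry Y i)"
    by (rule inner_tensor_superset) (auto simp: scaleR_tensor.rep_eq)
  then show "inner (scaleR c X) Y = c * inner X Y"
    by (simp add: inner_tensor_def scaleR_tensor.rep_eq sum_distrib_left mult.assoc)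
  show "0 \<le> inner X X"
    by (simp add: inner_tensor_def sum_nonneg)
  show "inner X X = 0 \<longleftrightarrow> X = 0"
  proof
    assume "inner X X = 0"
    then have "\<forall>i\<in>{i. entry X i \<noteq> 0}. entry X i * entry X i = 0"
      unfolding inner_tensor_def by (subst (asm) sum_nonneg_eq_0_iff) auto
    then show "X = 0"
      by (intro tensor_eqI) (auto simp: zero_tensor.rep_eq)
  qed (simp add: inner_tensor_def zero_tensor.rep_eq)
qed (simp_all add: norm_tensor_def sgn_tensor_def dist_tensor_def uniformity_tensor_def open_tensor_def)

end

definition indices :: "nat list \<Rightarrow> nat list set" where
  "indices n = {i. length i = length n \<and> (\<forall>k<length n. i ! k < n ! k)}"

definition tensors :: "nat list \<Rightarrow> tensor set" where
  "tensors n = {X. \<forall>i. i \<notin> indices n \<longrightarrow> entry X i = 0}"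

lemma indices_Nil [simp]: "indices [] = {[]}"
  by (auto simp: indices_def)

lemma Cons_indices [simp]: "x # i \<in> indices (m # n) \<longleftrightarrow> x < m \<and> i \<in> indices n"
  by (fastforce simp: indices_def All_less_Suc2)

lemma finite_indices [simp]: "finite (indices n)"
proof (rule finite_subset)
  show "indices n \<subseteq> {i. set i \<subseteq> {..<Suc (sum_list n)} \<and> length i = length n}"
  proof (clarsimp simp: indices_def in_set_conv_nth less_Suc_eq_le)
    fix i :: "nat list" and k
    assume "\<forall>k<length n. i ! k < n ! k" "k < length n"
    then show "i ! k \<le> sum_list n"
      by (meson elem_le_sum_list le_trans less_imp_le)
  qed
qed (simp add: finite_lists_length_eq)

lift_definition tensor_of :: "nat list \<Rightarrow> (nat list \<Rightarrow> real) \<Rightarrow> tensor" is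
  "\<lambda>n F i. if i \<in> indices n then F i else 0"
  by (rule finite_subset[OF _ finite_indices]) auto

lemma tensor_of_in_tensors [simp]: "tensor_of n F \<in> tensors n"
  by (simp add: tensors_def tensor_of.rep_eq)


section \<open>Unfoldings and mode products\<close>

text \<open>
  Columns of the mode-\<open>k\<close> unfolding are indexed by the multi-indices with the \<open>k\<close>-th
  entry removed, in the order in which the earliest index varies fastest.
\<close>

fun lin_index :: "nat list \<Rightarrow> nat list \<Rightarrow> nat" where
  "lin_index (m # n) (x # i) = x + m * lin_index n i"
| "lin_index _ _ = 0"

fun multi_index :: "nat list \<Rightarrow> nat \<Rightarrow> nat list" where
  "multi_index [] j = []"
| "multi_index (m # n) j = (j mod m) # multi_index n (j div m)"

definition delete_at :: "nat \<Rightarrow> 'a list \<Rightarrow> 'a list" where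
  "delete_at k xs = take k xs @ drop (Suc k) xs"

definition insert_at :: "nat \<Rightarrow> 'a \<Rightarrow> 'a list \<Rightarrow> 'a list" where
  "insert_at k x xs = take k xs @ x # drop k xs"

definition unfolding_mat :: "nat list \<Rightarrow> nat \<Rightarrow> tensor \<Rightarrow> real mat" where
  "unfolding_mat n k X =
     mat (n ! k) (prod_list (delete_at k n))
       (\<lambda>(x, j). entry X (insert_at k x (multi_index (delete_at k n) j)))"

definition folding :: "nat list \<Rightarrow> nat \<Rightarrow> real mat \<Rightarrow> tensor" where
  "folding n k M =
     tensor_of n (\<lambda>i. M $$ (i ! k, lin_index (delete_at k n) (delete_at k i)))"

definition mode_prod :: "nat list \<Rightarrow> nat \<Rightarrow> real mat \<Rightarrow> tensor \<Rightarrow> tensor" where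
  "mode_prod n k A X = folding (n[k := dim_row A]) k (A * unfolding_mat n k X)"

fun mode_prods :: "nat list \<Rightarrow> tensor \<Rightarrow> (nat \<times> real mat) list \<Rightarrow> tensor" where
  "mode_prods n X [] = X"
| "mode_prods n X ((k, A) # ps) = mode_prods (n[k := dim_row A]) (mode_prod n k A X) ps"

abbreviation modes :: "nat list \<Rightarrow> nat list" where
  "modes n \<equiv> [0..<length n]"

abbreviation other_modes :: "nat list \<Rightarrow> nat \<Rightarrow> nat list" where
  "other_modes n k \<equiv> filter (\<lambda>j. j \<noteq> k) [0..<length n]"

lemma length_multi_index [simp]: "length (multi_index n j) = length n"
  by (induction n arbitrary: j) auto

lemma multi_index_in_indices: "j < prod_list n \<Longrightarrow> multi_index n j \<in> indices n"
proof (induction n arbitrary: j)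
  case (Cons m n)
  then have "m > 0" by (cases m) auto
  moreover have "j div m < prod_list n"
    using Cons.prems by (simp add: less_mult_imp_div_less mult.commute)
  ultimately show ?case using Cons.IH by simp
qed auto

lemma lin_multi_index: "j < prod_list n \<Longrightarrow> lin_index n (multi_index n j) = j"
proof (induction n arbitrary: j)
  case (Cons m n)
  then have "j div m < prod_list n"
    by (simp add: less_mult_imp_div_less mult.commute)
  then show ?case using Cons.IH by simp
qed auto

lemma multi_lin_index:
  "i \<in> indices n \<Longrightarrow> lin_index n i < prod_list n \<and> multi_index n (lin_index n i) = i"
proof (induction n arbitrary: i)
  case (Cons m n)
  then obtain x i' where i: "i = x # i'" by (cases i) (auto simp: indices_def)
  with Cons.prems have x: "x < m" and i': "i' \<in> indices n" by simp_all
  have "Suc (lin_index n i') \<le> prod_list n" using Cons.IH[OF i'] by simp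
  then have "m * Suc (lin_index n i') \<le> m * prod_list n" by (rule mult_le_mono2)
  with x have "x + m * lin_index n i' < m * prod_list n" by simp
  with x show ?case using Cons.IH[OF i'] i by simp
qed auto

lemma length_delete_at: "k < length xs \<Longrightarrow> length (delete_at k xs) = length xs - 1"
  by (simp add: delete_at_def)

lemma delete_at_insert_at [simp]: "k \<le> length xs \<Longrightarrow> delete_at k (insert_at k x xs) = xs"
  by (simp add: delete_at_def insert_at_def)

lemma nth_insert_at [simp]: "k \<le> length xs \<Longrightarrow> insert_at k x xs ! k = x"
  by (simp add: insert_at_def nth_append)

lemma insert_at_delete_at [simp]:
  "k < length xs \<Longrightarrow> insert_at k (xs ! k) (delete_at k xs) = xs"
  by (simp add: delete_at_def insert_at_def id_take_nth_drop[symmetric])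

lemma delete_at_update [simp]: "delete_at k (xs[k := x]) = delete_at k xs"
  by (simp add: delete_at_def)

lemma indices_list_all2: "i \<in> indices n \<longleftrightarrow> list_all2 (<) i n"
  by (auto simp: indices_def list_all2_conv_all_nth)

lemma delete_at_in_indices: "i \<in> indices n \<Longrightarrow> delete_at k i \<in> indices (delete_at k n)"
  by (simp add: indices_list_all2 delete_at_def list_all2_appendI)

lemma insert_at_in_indices:
  assumes "k < length n" "x < n ! k" "i \<in> indices (delete_at k n)"
  shows "insert_at k x i \<in> indices n"
proof -
  have "insert_at k (n ! k) (delete_at k n) = n" using assms(1) by simp
  moreover have "insert_at k x i \<in> indices (insert_at k (n ! k) (delete_at k n))"
    using assms(2,3)
    by (simp add: indices_list_all2 insert_at_def list_all2_appendI)
  ultimately show ?thesis by simp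
qed

lemma folding_unfolding_mat:
  assumes "k < length n" "X \<in> tensors n"
  shows "folding n k (unfolding_mat n k X) = X"
proof (rule tensor_eqI)
  fix i
  show "entry (folding n k (unfolding_mat n k X)) i = entry X i"
  proof (cases "i \<in> indices n")
    case True
    then have "i ! k < n ! k" "k < length i" using assms by (auto simp: indices_def)
    with multi_lin_index[OF delete_at_in_indices[OF True, of k]] True show ?thesis
      by (simp add: folding_def unfolding_mat_def tensor_of.rep_eq)
  qed (use assms in \<open>auto simp: folding_def tensor_of.rep_eq tensors_def\<close>)
qed

lemma unfolding_mat_folding:
  assumes "k < length n" "M \<in> carrier_mat (n ! k) (prod_list (delete_at k n))"
  shows "unfolding_mat n k (folding n k M) = M"
proof (rule eq_matI)
  fix x j assume "x < dim_row M" "j < dim_col M"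
  with assms have x: "x < n ! k" and j: "j < prod_list (delete_at k n)" by auto
  have "insert_at k x (multi_index (delete_at k n) j) \<in> indices n"
    using assms(1) x multi_index_in_indices[OF j] by (rule insert_at_in_indices)
  moreover have "k \<le> length (multi_index (delete_at k n) j)"
    using assms(1) by (simp add: length_delete_at)
  ultimately show "unfolding_mat n k (folding n k M) $$ (x, j) = M $$ (x, j)"
    using x j by (simp add: unfolding_mat_def folding_def tensor_of.rep_eq lin_multi_index)
qed (use assms in \<open>auto simp: unfolding_mat_def\<close>)

lemma unfolding_mat_mode_prod:
  assumes "k < length n"
  shows "unfolding_mat (n[k := dim_row A]) k (mode_prod n k A X) = A * unfolding_mat n k X"
  unfolding mode_prod_def
  by (rule unfolding_mat_folding) (use assms in \<open>auto simp: unfolding_mat_def\<close>)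


section \<open>Matrices\<close>

definition mat_rank :: "real mat \<Rightarrow> nat" where
  "mat_rank A = vec_space.rank (dim_row A) A"

definition stiefel :: "nat \<Rightarrow> nat \<Rightarrow> real mat set" where
  "stiefel p n = {U \<in> carrier_mat n p. transpose_mat U * U = 1\<^sub>m p}"

definition is_pinv :: "real mat \<Rightarrow> real mat \<Rightarrow> bool" where
  "is_pinv A B \<longleftrightarrow> B \<in> carrier_mat (dim_col A) (dim_row A)
     \<and> A * B * A = A \<and> B * A * B = B
     \<and> transpose_mat (A * B) = A * B \<and> transpose_mat (B * A) = B * A"

definition pinv :: "real mat \<Rightarrow> real mat" where
  "pinv A = (THE B. is_pinv A B)"

definition hcat :: "real mat \<Rightarrow> real mat \<Rightarrow> real mat" where
  "hcat A B = mat_of_cols (dim_row A) (cols A @ cols B)"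

definition orth_proj :: "real mat \<Rightarrow> real mat" where
  "orth_proj S = S * transpose_mat S"

definition orth_proj_compl :: "real mat \<Rightarrow> real mat" where
  "orth_proj_compl S = 1\<^sub>m (dim_row S) - S * transpose_mat S"

definition is_svd :: "real mat \<Rightarrow> real mat \<Rightarrow> real mat \<Rightarrow> real mat \<Rightarrow> bool" where
  "is_svd A W D V \<longleftrightarrow>
     W \<in> stiefel (dim_row A) (dim_row A) \<and> V \<in> stiefel (dim_col A) (dim_col A)
     \<and> D \<in> carrier_mat (dim_row A) (dim_col A)
     \<and> (\<forall>i<dim_row A. \<forall>j<dim_col A. i \<noteq> j \<longrightarrow> D $$ (i, j) = 0)
     \<and> (\<forall>i<min (dim_row A) (dim_col A). 0 \<le> D $$ (i, i))
     \<and> (\<forall>i j. i \<le> j \<and> j < min (dim_row A) (dim_col A) \<longrightarrow> D $$ (j, j) \<le> D $$ (i, i))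
     \<and> A = W * D * transpose_mat V"

text \<open>
  The SVD is a full one, so there are always \<open>dim_row A\<close> left singular vectors, also when \<open>A\<close> has
  fewer columns than rows.
\<close>

definition leading_left_singular :: "nat \<Rightarrow> real mat \<Rightarrow> real mat \<Rightarrow> bool" where
  "leading_left_singular p A U \<longleftrightarrow>
     (\<exists>W D V. is_svd A W D V \<and> U = mat_of_cols (dim_row A) (take p (cols W)))"


section \<open>Tucker varieties, HOSVD and the approximate projection\<close>

definition rank_tc :: "nat list \<Rightarrow> tensor \<Rightarrow> nat list" where
  "rank_tc n X = map (\<lambda>k. mat_rank (unfolding_mat n k X)) (modes n)"

definition tucker_variety :: "nat list \<Rightarrow> nat list \<Rightarrow> tensor set" where
  "tucker_variety n r = {X \<in> tensors n. list_all2 (\<le>) (rank_tc n X) r}"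

text \<open>A relation, since leading singular vectors need not be unique.\<close>

definition is_hosvd_proj :: "nat list \<Rightarrow> nat list \<Rightarrow> tensor \<Rightarrow> tensor \<Rightarrow> bool" where
  "is_hosvd_proj n r A Y \<longleftrightarrow>
     (\<exists>U. (\<forall>k<length n. leading_left_singular (r ! k) (unfolding_mat n k A) (U k))
        \<and> Y = mode_prods n A (map (\<lambda>k. (k, orth_proj (U k))) (modes n)))"

definition tucker_decomp ::
    "nat list \<Rightarrow> tensor \<Rightarrow> nat list \<Rightarrow> tensor \<Rightarrow> (nat \<Rightarrow> real mat) \<Rightarrow> bool" where
  "tucker_decomp n X q G U \<longleftrightarrow>
     rank_tc n X = q \<and> G \<in> tensors q \<and> (\<forall>k<length n. U k \<in> stiefel (q ! k) (n ! k))
     \<and> X = mode_prods q G (map (\<lambda>k. (k, U k)) (modes n))"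

text \<open>
  Here \<open>q\<close> is the size of the core \<open>G\<close>, and \<open>q[k := n ! k]\<close> is the size of the product of \<open>A\<close> with
  the matrices \<open>U j\<^sup>T\<close> along all modes \<open>j\<close> except \<open>k\<close>.
\<close>

definition approx_proj ::
    "nat list \<Rightarrow> nat list \<Rightarrow> tensor \<Rightarrow> (nat \<Rightarrow> real mat) \<Rightarrow> (nat \<Rightarrow> real mat) \<Rightarrow> tensor \<Rightarrow> tensor" where
  "approx_proj n q G U U1 A =
     (let S = (\<lambda>k. hcat (U k) (U1 k)) in
      mode_prods n A (map (\<lambda>k. (k, orth_proj (S k))) (modes n))
      + (\<Sum>k<length n.
           mode_prods q G
             ((k, orth_proj_compl (S k)
                  * unfolding_mat (q[k := n ! k]) k
                      (mode_prods n A (map (\<lambda>j. (j, transpose_mat (U j))) (other_modes n k)))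
                  * pinv (unfolding_mat q k G))
              # map (\<lambda>j. (j, U j)) (other_modes n k))))"

definition is_approx_proj :: "nat list \<Rightarrow> nat list \<Rightarrow> tensor \<Rightarrow> tensor \<Rightarrow> tensor \<Rightarrow> bool" where
  "is_approx_proj n r X A g \<longleftrightarrow>
     (\<exists>q G U U1. tucker_decomp n X q G U \<and> list_all2 (\<le>) q r
        \<and> (\<forall>k<length n. U1 k \<in> stiefel (r ! k - q ! k) (n ! k)
             \<and> transpose_mat (U k) * U1 k = 0\<^sub>m (q ! k) (r ! k - q ! k))
        \<and> g = approx_proj n q G U U1 A)"


section \<open>Gradients, tangent cones and metric projections\<close>

text \<open>
  Derivatives are taken within a linear subspace \<open>S\<close>; values of \<open>f\<close> outside \<open>S\<close> play no role.
\<close>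

primrec Ck_on :: "nat \<Rightarrow> 'a::real_normed_vector set \<Rightarrow> ('a \<Rightarrow> real) \<Rightarrow> bool" where
  "Ck_on 0 S f \<longleftrightarrow> continuous_on S f"
| "Ck_on (Suc k) S f \<longleftrightarrow>
     (\<exists>f'. (\<forall>x\<in>S. (f has_derivative f' x) (at x within S))
         \<and> (\<forall>v\<in>S. Ck_on k S (\<lambda>x. f' x v)))"

definition smooth_on :: "'a::real_normed_vector set \<Rightarrow> ('a \<Rightarrow> real) \<Rightarrow> bool" where
  "smooth_on S f \<longleftrightarrow> (\<forall>k. Ck_on k S f)"

definition grad :: "'a::real_inner set \<Rightarrow> ('a \<Rightarrow> real) \<Rightarrow> 'a \<Rightarrow> 'a" where
  "grad S f x = (THE D. D \<in> S \<and> (f has_derivative (\<lambda>h. inner D h)) (at x within S))"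

definition tangent_cone :: "'a::real_normed_vector set \<Rightarrow> 'a \<Rightarrow> 'a set" where
  "tangent_cone M x =
     {v. \<exists>y t. (\<forall>i. y i \<in> M) \<and> y \<longlonglongrightarrow> x \<and> (\<forall>i. 0 < t i) \<and> t \<longlonglongrightarrow> 0
          \<and> (\<lambda>i. (y i - x) /\<^sub>R t i) \<longlonglongrightarrow> v}"

definition is_metric_proj :: "'a::real_normed_vector set \<Rightarrow> 'a \<Rightarrow> 'a \<Rightarrow> bool" where
  "is_metric_proj C a v \<longleftrightarrow> v \<in> C \<and> (\<forall>w\<in>C. norm (a - v) \<le> norm (a - w))"

definition metric_proj :: "'a::real_normed_vector set \<Rightarrow> 'a \<Rightarrow> 'a" where
  "metric_proj C a = (SOME v. is_metric_proj C a v)"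

text \<open>
  For tangent cones, the norm of \<open>metric_proj C a\<close> does not depend on the choice of minimizer.
\<close>

lemma tangent_cone_scaleR:
  assumes "v \<in> tangent_cone M x" "0 < (c::real)"
  shows "c *\<^sub>R v \<in> tangent_cone M x"
proof -
  from assms(1) obtain y t where *: "\<forall>i. y i \<in> M" "y \<longlonglongrightarrow> x" "\<forall>i. 0 < t i" "t \<longlonglongrightarrow> 0"
      "(\<lambda>i. (y i - x) /\<^sub>R t i) \<longlonglongrightarrow> v"
    unfolding tangent_cone_def by blast
  have "(\<lambda>i. c *\<^sub>R ((y i - x) /\<^sub>R t i)) \<longlonglongrightarrow> c *\<^sub>R v"
    using *(5) by (intro tendsto_intros)
  moreover have "(\<lambda>i. c *\<^sub>R ((y i - x) /\<^sub>R t i)) = (\<lambda>i. (y i - x) /\<^sub>R (t i / c))"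
    by (simp add: divide_inverse mult.commute)
  moreover have "(\<lambda>i. t i / c) \<longlonglongrightarrow> 0"
    using tendsto_divide[OF *(4) tendsto_const, of c] assms(2) by simp
  ultimately have "(\<forall>i. y i \<in> M) \<and> y \<longlonglongrightarrow> x \<and> (\<forall>i. 0 < t i / c) \<and> (\<lambda>i. t i / c) \<longlonglongrightarrow> 0
      \<and> (\<lambda>i. (y i - x) /\<^sub>R (t i / c)) \<longlonglongrightarrow> c *\<^sub>R v"
    using * assms(2) by simp
  then show ?thesis
    unfolding tangent_cone_def mem_Collect_eq
    by (rule_tac exI[of _ y], rule_tac exI[of _ "\<lambda>i. t i / c"])
qed

lemma metric_proj_inner:
  fixes a v :: "'a::real_inner"
  assumes "is_metric_proj (tangent_cone M x) a v"
  shows "inner a v = (norm v)\<^sup>2"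
proof (cases "v = 0")
  case False
  define b where "b = inner a v / (norm v)\<^sup>2"
  have sq: "(norm (a - c *\<^sub>R v))\<^sup>2 = (norm a)\<^sup>2 - 2 * c * inner a v + c\<^sup>2 * (norm v)\<^sup>2" for c
    by (simp only: power2_norm_eq_inner)
      (simp add: inner_diff inner_commute algebra_simps power2_eq_square)
  have le: "1\<^sup>2 * (norm v)\<^sup>2 - 2 * inner a v \<le> c\<^sup>2 * (norm v)\<^sup>2 - 2 * c * inner a v" if "0 < c" for c
  proof -
    have "norm (a - 1 *\<^sub>R v) \<le> norm (a - c *\<^sub>R v)"
      using assms that tangent_cone_scaleR unfolding is_metric_proj_def by (simp; blast)
    then have "(norm (a - 1 *\<^sub>R v))\<^sup>2 \<le> (norm (a - c *\<^sub>R v))\<^sup>2"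
      by (intro power_mono) auto
    then show ?thesis unfolding sq by simp
  qed
  have nz: "0 < (norm v)\<^sup>2" using False by simp
  have ab: "inner a v = b * (norm v)\<^sup>2" using nz by (simp add: b_def)
  have le': "1 - 2 * b \<le> c\<^sup>2 - 2 * c * b" if "0 < c" for c
  proof -
    have "(1 - 2 * b) * (norm v)\<^sup>2 \<le> (c\<^sup>2 - 2 * c * b) * (norm v)\<^sup>2"
      using le[OF that] unfolding ab by (simp add: algebra_simps)
    then show ?thesis using nz by (simp only: mult_le_cancel_right_pos)
  qed
  have "b = 1"
  proof (cases "0 < b")
    case True
    have "(b - 1)\<^sup>2 \<le> 0"
      using le'[OF True] by (simp add: power2_eq_square algebra_simps)
    then show ?thesis by simp
  next
    case False
    have "1 - 2 * b \<le> (1/2)\<^sup>2 - 2 * (1/2) * b" by (rule le') simp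
    then show ?thesis using False by (simp add: power2_eq_square)
  qed
  then show ?thesis using ab by simp
qed simp

lemma norm_metric_proj_unique:
  fixes a v w :: "'a::real_inner"
  assumes "is_metric_proj (tangent_cone M x) a v" "is_metric_proj (tangent_cone M x) a w"
  shows "norm v = norm w"
proof -
  have eq: "(norm (a - u))\<^sup>2 = (norm a)\<^sup>2 - (norm u)\<^sup>2" if "inner a u = (norm u)\<^sup>2" for u
    using that by (simp add: power2_norm_eq_inner inner_diff inner_commute)
  have "norm (a - v) = norm (a - w)"
    using assms by (auto simp: is_metric_proj_def intro: antisym)
  then have "(norm v)\<^sup>2 = (norm w)\<^sup>2"
    using eq[OF metric_proj_inner[OF assms(1)]] eq[OF metric_proj_inner[OF assms(2)]] by simp
  then show ?thesis by simp
qed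


section \<open>The GRAP method\<close>

text \<open>
  An angle is only formed with a nonzero direction: the inequality alone holds trivially for
  \<open>g = 0\<close>, which would let the method accept the zero direction, and hence stall, at a
  non-stationary point. So \<open>g = 0\<close> is accepted only where the projection \<open>p\<close> vanishes. Equivalently,
  the inequality is imposed after division by \<open>norm g\<close>.
\<close>

definition angle_condition :: "real \<Rightarrow> tensor \<Rightarrow> tensor \<Rightarrow> tensor \<Rightarrow> bool" where
  "angle_condition \<omega> A p g \<longleftrightarrow> inner A g \<ge> \<omega> * norm p * norm g \<and> (g = 0 \<longrightarrow> p = 0)"

text \<open>
  In a step, \<open>Y m\<close> is the trial point computed for the stepsize \<open>\<rho> ^ m * s0\<close>.
\<close>

definition grap_step ::
    "nat list \<Rightarrow> nat list \<Rightarrow> (tensor \<Rightarrow> real) \<Rightarrow> real \<Rightarrow> real \<Rightarrow> real \<Rightarrow> real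
     \<Rightarrow> tensor \<Rightarrow> tensor \<Rightarrow> bool" where
  "grap_step n r f \<omega> \<rho> a smin X X' \<longleftrightarrow>
     (let A = - grad (tensors n) f X in
      \<exists>g s0 l Y.
        is_approx_proj n r X A g
        \<and> angle_condition \<omega> A (metric_proj (tangent_cone (tucker_variety n r) X) A) g
        \<and> 0 < s0 \<and> \<rho> ^ l * s0 > smin
        \<and> (\<forall>m\<le>l. is_hosvd_proj n r (X + (\<rho> ^ m * s0) *\<^sub>R g) (Y m))
        \<and> f X - f (Y l) \<ge> \<rho> ^ l * s0 * a * inner A g
        \<and> (\<forall>m<l. \<not> f X - f (Y m) \<ge> \<rho> ^ m * s0 * a * inner A g)
        \<and> X' = Y l)"

definition grap_sequence ::
    "nat list \<Rightarrow> nat list \<Rightarrow> (tensor \<Rightarrow> real) \<Rightarrow> real \<Rightarrow> real \<Rightarrow> real \<Rightarrow> real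
     \<Rightarrow> (nat \<Rightarrow> tensor) \<Rightarrow> bool" where
  "grap_sequence n r f \<omega> \<rho> a smin X \<longleftrightarrow>
     X 0 \<in> tucker_variety n r \<and> (\<forall>t. grap_step n r f \<omega> \<rho> a smin (X t) (X (Suc t)))"

end

theory Submission
  imports Defs
begin

text \<open>
  Write A for the negative gradient at the current iterate, p for the projection of A onto the tangent
  cone and g for the search direction. The map \<open>A \<mapsto> g\<close> is an orthogonal projection onto a linear
  space, so \<open>inner A g = (norm g)\<^sup>2\<close> (\<open>is_approx_proj_inner\<close>). With this identity the angle condition
  says \<open>\<omega> * norm p \<le> norm g\<close>, and hence \<open>inner A g \<ge> \<omega>\<^sup>2 * (norm p)\<^sup>2\<close>
  (\<open>angle_condition_lower_bound\<close>). As the stepsizes are bounded below by \<open>smin\<close>, the Armijo condition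
  gives \<open>f (X t) - f (X (Suc t)) \<ge> smin * a * \<omega>\<^sup>2 * (norm p)\<^sup>2\<close>. Summing over t and using the lower
  bound of f yields both the limit and the iteration count (\<open>sufficient_decrease_tendsto\<close>,
  \<open>sufficient_decrease_count\<close>).

  That \<open>A \<mapsto> g\<close> is an orthogonal projection (\<open>inner_approx_proj\<close>) rests on the defining identities
  of the pseudoinverse of each core unfolding G. They hold for \<open>G\<^sup>T * (G * G\<^sup>T)\<^bsup>-1\<^esup>\<close>, since G has full
  row rank: the core has the size of the multilinear rank of the iterate
  (\<open>tucker_core_row_independent\<close>). The iterates stay in the Tucker variety because every result of
  the HOSVD projection lies there (\<open>hosvd_proj_in_tucker_variety\<close>). All of this uses the calculus of
  products along pairwise distinct modes: such factors commute, so a further factor in one mode can be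
  merged with the one that is already there or moved past the others.
\<close>


section \<open>Rank of matrix products\<close>

text \<open>
  The columns of \<open>C * D\<close> lie in the column space of C, which is spanned by p vectors.
\<close>

lemma mat_rank_mult_le:
  assumes C: "C \<in> carrier_mat n p" and D: "D \<in> carrier_mat p m"
  shows "mat_rank (C * D) \<le> p"
proof -
  interpret vec_space "TYPE(real)" n .
  have CD: "C * D \<in> carrier_mat n m" using C D by simp
  have colsC: "set (cols C) \<subseteq> carrier_vec n" using C cols_dim by blast
  have colsCD: "set (cols (C * D)) \<subseteq> carrier_vec n" using CD cols_dim by blast
  have "set (cols (C * D)) \<subseteq> span (set (cols C))"
  proof
    fix x assume "x \<in> set (cols (C * D))"
    then obtain j where j: "j < m" "x = col (C * D) j"
      using CD by (metis carrier_matD(2) cols_length cols_nth in_set_conv_nth)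
    have "x = C *\<^sub>v col D j" using j col_mult2[OF C D] by blast
    moreover have "col D j \<in> carrier_vec p" using D by auto
    ultimately show "x \<in> span (set (cols C))"
      using col_space_eq[OF C] C unfolding col_space_def by auto
  qed
  then have sub: "span (set (cols (C * D))) \<subseteq> span (set (cols C))"
    using colsC by (simp add: span_is_submodule span_is_subset)
  have "subspace class_ring (span (set (cols (C * D)))) (span_vs (set (cols C)))"
    using nested_subspaces[OF span_is_subspace span_is_subspace sub] colsC colsCD by simp
  then have "vectorspace.dim class_ring (span_vs (set (cols (C * D))))
      \<le> vectorspace.dim class_ring (span_vs (set (cols C)))"
    using vectorspace.subspace_dim[OF subspace_is_vs[OF span_is_subspace]]
      colsC fin_dim_span_cols[OF C] fin_dim_span_cols[OF CD] by simp
  then have "rank (C * D) \<le> rank C" unfolding rank_def .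
  also have "\<dots> \<le> p" using rank_le_nc[OF C] .
  finally show ?thesis using C by (simp add: mat_rank_def)
qed

text \<open>
  A linear relation B among the rows of Z lets the product factor through one dimension less.
  This is what shows below that the core unfoldings of a Tucker decomposition have full row rank.
\<close>

lemma mat_rank_mult_less:
  assumes C: "C \<in> carrier_mat n p" and Z: "Z \<in> carrier_mat p m"
    and B: "B \<in> carrier_mat b p" "B * Z = 0\<^sub>m b m" "B \<noteq> 0\<^sub>m b p"
  shows "mat_rank (C * Z) < p"
proof -
  \<comment> \<open>Row i of Z is a combination of the other rows, since B has a nonzero entry in column i.\<close>
  obtain c i where ci: "c < b" "i < p" "B $$ (c, i) \<noteq> 0"
  proof -
    have "\<exists>c i. c < b \<and> i < p \<and> B $$ (c, i) \<noteq> 0"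
    proof (rule ccontr)
      assume "\<not> ?thesis"
      then have "B = 0\<^sub>m b p" using B(1) by (intro eq_matI) auto
      with B(3) show False by simp
    qed
    then show thesis using that by blast
  qed
  obtain p' where p': "p = Suc p'" using ci(2) by (cases p) auto
  \<comment> \<open>So \<open>Z = E * Z'\<close>, where \<open>Z'\<close> drops that row; \<open>?w\<close> enumerates the rows that stay.\<close>
  let ?w = "insert_index i"
  define E where "E = mat p p' (\<lambda>(x, y). if x = i then - B $$ (c, ?w y) / B $$ (c, i)
      else if x = ?w y then 1 else 0)"
  define Z' where "Z' = mat p' m (\<lambda>(y, j). Z $$ (?w y, j))"
  have img: "?w ` {0..<p'} = {0..<p} - {i}"
    using insert_index_image[of i p'] ci(2) p' by simp
  have inj: "inj_on ?w {0..<p'}" by (rule insert_index_inj_on)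
  have rei: "(\<Sum>y\<in>{0..<p'}. h (?w y)) = (\<Sum>z\<in>{0..<p} - {i}. h z)" for h :: "nat \<Rightarrow> real"
    using sum.reindex[OF inj, of h] img by simp
  have "Z = E * Z'"
  proof (rule eq_matI)
    fix x j assume "x < dim_row (E * Z')" "j < dim_col (E * Z')"
    then have x: "x < p" and j: "j < m" by (auto simp: E_def Z'_def)
    have rowB: "(\<Sum>z\<in>{0..<p}. B $$ (c, z) * Z $$ (z, j)) = 0"
    proof -
      have "(B * Z) $$ (c, j) = 0" using B(2) ci(1) j by simp
      then show ?thesis using B(1) Z ci(1) j by (simp add: scalar_prod_def)
    qed
    have "(E * Z') $$ (x, j) = (\<Sum>y\<in>{0..<p'}. (if x = i then - B $$ (c, ?w y) / B $$ (c, i)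
        else if x = ?w y then 1 else 0) * Z $$ (?w y, j))"
      using x j by (simp add: E_def Z'_def scalar_prod_def)
    also have "\<dots> = (\<Sum>z\<in>{0..<p} - {i}. (if x = i then - B $$ (c, z) / B $$ (c, i)
        else if x = z then 1 else 0) * Z $$ (z, j))"
      by (rule rei)
    also have "\<dots> = Z $$ (x, j)"
    proof (cases "x = i")
      case True
      have "(\<Sum>z\<in>{0..<p} - {i}. B $$ (c, z) * Z $$ (z, j)) = - B $$ (c, i) * Z $$ (i, j)"
        using rowB ci(2) by (simp add: sum_diff1)
      then have "(\<Sum>z\<in>{0..<p} - {i}. - B $$ (c, z) / B $$ (c, i) * Z $$ (z, j)) = Z $$ (i, j)"
        using ci(3) by (simp add: sum_negf sum_divide_distrib[symmetric])
      then show ?thesis using True by simp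
    next
      case False
      have "(\<Sum>z\<in>{0..<p} - {i}. (if x = z then 1 else 0) * Z $$ (z, j))
          = (\<Sum>z\<in>{0..<p} - {i}. if x = z then Z $$ (z, j) else 0)"
        by (intro sum.cong) auto
      then show ?thesis using False x by simp
    qed
    finally show "Z $$ (x, j) = (E * Z') $$ (x, j)" by simp
  qed (use Z in \<open>auto simp: E_def Z'_def\<close>)
  moreover have E: "E \<in> carrier_mat p p'" and Z': "Z' \<in> carrier_mat p' m"
    by (simp_all add: E_def Z'_def)
  ultimately have "C * Z = (C * E) * Z'" using C by simp
  moreover have "mat_rank ((C * E) * Z') \<le> p'"
    by (rule mat_rank_mult_le[OF mult_carrier_mat[OF C E] Z'])
  ultimately show ?thesis using p' by simp
qed

section \<open>The Frobenius inner product of matrices\<close>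

definition mat_inner :: "real mat \<Rightarrow> real mat \<Rightarrow> real" where
  "mat_inner M N = (\<Sum>x<dim_row M. \<Sum>j<dim_col M. M $$ (x, j) * N $$ (x, j))"

lemma mat_inner_commute:
  "M \<in> carrier_mat p m \<Longrightarrow> N \<in> carrier_mat p m \<Longrightarrow> mat_inner M N = mat_inner N M"
  unfolding mat_inner_def by (intro sum.cong) (auto simp: mult.commute)

lemma mat_inner_mult_left:
  assumes "A \<in> carrier_mat p q" "M \<in> carrier_mat q m" "N \<in> carrier_mat p m"
  shows "mat_inner (A * M) N = mat_inner M (transpose_mat A * N)"
proof -
  have "mat_inner (A * M) N
      = (\<Sum>x<p. \<Sum>j<m. \<Sum>y<q. A $$ (x, y) * M $$ (y, j) * N $$ (x, j))"
    unfolding mat_inner_def using assms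
    by (auto intro!: sum.cong simp: scalar_prod_def atLeast0LessThan sum_distrib_right)
  also have "\<dots> = (\<Sum>y<q. \<Sum>x<p. \<Sum>j<m. A $$ (x, y) * M $$ (y, j) * N $$ (x, j))"
    by (rule trans[OF sum.cong[OF refl sum.swap] sum.swap])
  also have "\<dots> = (\<Sum>y<q. \<Sum>j<m. \<Sum>x<p. A $$ (x, y) * M $$ (y, j) * N $$ (x, j))"
    by (rule sum.cong[OF refl], rule sum.swap)
  also have "\<dots> = mat_inner M (transpose_mat A * N)"
    unfolding mat_inner_def using assms
    by (auto intro!: sum.cong simp: scalar_prod_def atLeast0LessThan sum_distrib_left mult_ac)
  finally show ?thesis .
qed

lemma mat_inner_mult_right:
  assumes "M \<in> carrier_mat p q" "H \<in> carrier_mat q m" "N \<in> carrier_mat p m"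
  shows "mat_inner (M * H) N = mat_inner M (N * transpose_mat H)"
proof -
  have "mat_inner (M * H) N
      = (\<Sum>x<p. \<Sum>j<m. \<Sum>y<q. M $$ (x, y) * H $$ (y, j) * N $$ (x, j))"
    unfolding mat_inner_def using assms
    by (auto intro!: sum.cong simp: scalar_prod_def atLeast0LessThan sum_distrib_right)
  also have "\<dots> = (\<Sum>x<p. \<Sum>y<q. \<Sum>j<m. M $$ (x, y) * H $$ (y, j) * N $$ (x, j))"
    by (rule sum.cong[OF refl], rule sum.swap)
  also have "\<dots> = mat_inner M (N * transpose_mat H)"
    unfolding mat_inner_def using assms
    by (auto intro!: sum.cong simp: scalar_prod_def atLeast0LessThan sum_distrib_left mult_ac)
  finally show ?thesis .
qed

lemma mat_inner_self_eq_0: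
  assumes "mat_inner M M = 0"
  shows "M = 0\<^sub>m (dim_row M) (dim_col M)"
proof (rule eq_matI)
  fix x j assume "x < dim_row (0\<^sub>m (dim_row M) (dim_col M) :: real mat)"
    "j < dim_col (0\<^sub>m (dim_row M) (dim_col M) :: real mat)"
  then have x: "x < dim_row M" and j: "j < dim_col M" by auto
  have "\<forall>x<dim_row M. (\<Sum>j<dim_col M. M $$ (x, j) * M $$ (x, j)) = 0"
    using assms unfolding mat_inner_def by (subst (asm) sum_nonneg_eq_0_iff) (auto intro: sum_nonneg)
  then have "(\<Sum>j<dim_col M. M $$ (x, j) * M $$ (x, j)) = 0" using x by simp
  then have "M $$ (x, j) * M $$ (x, j) = 0"
    using j by (subst (asm) sum_nonneg_eq_0_iff) auto
  then show "M $$ (x, j) = 0\<^sub>m (dim_row M) (dim_col M) $$ (x, j)" using x j by simp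
qed auto

text \<open>
  \<open>M \<mapsto> R * M * H\<close> is an orthogonal projection for the Frobenius inner product when R and H are
  orthogonal projections.
\<close>

lemma mat_inner_sandwich:
  assumes R: "R \<in> carrier_mat p p" "transpose_mat R = R" "R * R = R"
    and H: "H \<in> carrier_mat m m" "transpose_mat H = H" "H * H = H"
    and M: "M \<in> carrier_mat p m"
  shows "mat_inner (R * M * H) (R * M * H) = mat_inner M (R * M * H)"
proof -
  have RM: "R * M \<in> carrier_mat p m" using R M by simp
  then have RMH: "R * M * H \<in> carrier_mat p m" using H by simp
  have "mat_inner (R * M * H) (R * M * H) = mat_inner (R * M) (R * M * H * transpose_mat H)"
    by (rule mat_inner_mult_right[OF RM H(1) RMH])
  also have "R * M * H * transpose_mat H = R * M * H"
    using assoc_mult_mat[OF RM H(1) H(1)] H by simp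
  also have "mat_inner (R * M) \<dots> = mat_inner M (transpose_mat R * (R * M * H))"
    by (rule mat_inner_mult_left[OF R(1) M RMH])
  also have "transpose_mat R * (R * M * H) = R * M * H"
  proof -
    have "R * (R * M * H) = R * (R * M) * H" by (rule assoc_mult_mat[OF R(1) RM H(1), symmetric])
    also have "R * (R * M) = R * R * M" by (rule assoc_mult_mat[OF R(1) R(1) M, symmetric])
    finally show ?thesis using R by simp
  qed
  finally show ?thesis .
qed

section \<open>Pseudoinverses of matrices of full row rank\<close>

text \<open>
  Transposing \<open>A * B = (A * C) * (A * B)\<close> gives \<open>A * B = (A * B) * (A * C) = A * C\<close>, and likewise
  \<open>B * A = C * A\<close>; so B is determined by A.
\<close>

lemma is_pinv_unique:
  assumes "is_pinv A B" "is_pinv A C"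
  shows "B = C"
proof -
  define m n where "m = dim_row A" and "n = dim_col A"
  have A: "A \<in> carrier_mat m n" by (simp add: m_def n_def)
  have B: "B \<in> carrier_mat n m" and C: "C \<in> carrier_mat n m"
    using assms by (auto simp: is_pinv_def m_def n_def)
  have Bs: "A * B * A = A" "B * A * B = B" "transpose_mat (A * B) = A * B" "transpose_mat (B * A) = B * A"
    using assms(1) by (auto simp: is_pinv_def)
  have Cs: "A * C * A = A" "C * A * C = C" "transpose_mat (A * C) = A * C" "transpose_mat (C * A) = C * A"
    using assms(2) by (auto simp: is_pinv_def)
  have "A * B = (A * C * A) * B" using Cs(1) by simp
  also have "\<dots> = (A * C) * (A * B)" by (rule assoc_mult_mat[of _ m m _ n]) (use A B C in auto)
  also have "\<dots> = transpose_mat (A * C) * transpose_mat (A * B)" using Bs Cs by simp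
  also have "\<dots> = transpose_mat ((A * B) * (A * C))"
    by (rule transpose_mult[symmetric]) (use A B C in auto)
  also have "(A * B) * (A * C) = (A * B * A) * C" by (rule assoc_mult_mat[of _ m m _ n, symmetric]) (use A B C in auto)
  also have "transpose_mat \<dots> = A * C" using Bs(1) Cs(3) by simp
  finally have AB: "A * B = A * C" .
  have "B * A = B * (A * (C * A))" using Cs(1) A C by simp
  also have "\<dots> = (B * A) * (C * A)" by (rule assoc_mult_mat[of _ n m _ n, symmetric]) (use A B C in auto)
  also have "\<dots> = transpose_mat (B * A) * transpose_mat (C * A)" using Bs Cs by simp
  also have "\<dots> = transpose_mat ((C * A) * (B * A))"
    by (rule transpose_mult[symmetric]) (use A B C in auto)
  also have "(C * A) * (B * A) = C * (A * (B * A))" by (rule assoc_mult_mat[of _ n m _ n]) (use A B C in auto)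
  also have "A * (B * A) = A" using Bs(1) A B by simp
  also have "transpose_mat (C * A) = C * A" by (rule Cs(4))
  finally have BA: "B * A = C * A" .
  have "B = (C * A) * B" using Bs(2) BA by simp
  also have "\<dots> = C * (A * B)" using A B C by simp
  also have "\<dots> = C * (A * C)" using AB by simp
  also have "\<dots> = C * A * C" using A B C by simp
  also have "\<dots> = C" using Cs by simp
  finally show ?thesis .
qed

text \<open>
  A matrix G with linearly independent rows has the invertible Gram matrix \<open>G * G\<^sup>T\<close>, and
  \<open>G\<^sup>T * (G * G\<^sup>T)\<^bsup>-1\<^esup>\<close> is its pseudoinverse.
\<close>

lemma is_pinv_pinv:
  assumes G: "G \<in> carrier_mat q m"
    and cancel: "\<And>B. B \<in> carrier_mat 1 q \<Longrightarrow> B * G = 0\<^sub>m 1 m \<Longrightarrow> B = 0\<^sub>m 1 q"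
  shows "is_pinv G (pinv G)"
proof -
  define K where "K = G * transpose_mat G"
  have GT: "transpose_mat G \<in> carrier_mat m q" using G by simp
  have K: "K \<in> carrier_mat q q" using G by (simp add: K_def)
  have Ksym: "transpose_mat K = K"
    unfolding K_def using transpose_mult[OF G GT] by simp
  \<comment> \<open>A row B with \<open>B * K = 0\<close> has \<open>B * G\<close> of Frobenius norm 0.\<close>
  have "det K \<noteq> 0"
  proof
    assume "det K = 0"
    then obtain v where v: "v \<in> carrier_vec q" "v \<noteq> 0\<^sub>v q" "K *\<^sub>v v = 0\<^sub>v q"
      using det_0_iff_vec_prod_zero_field[OF K] by blast
    define B where "B = mat 1 q (\<lambda>(_, j). v $ j)"
    have B: "B \<in> carrier_mat 1 q" by (simp add: B_def)
    have BK: "B * K = 0\<^sub>m 1 q"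
    proof (rule eq_matI)
      fix x j assume "x < dim_row (0\<^sub>m 1 q :: real mat)" "j < dim_col (0\<^sub>m 1 q :: real mat)"
      then have x: "x = 0" and j: "j < q" by auto
      have "(B * K) $$ (0, j) = (\<Sum>y\<in>{0..<q}. v $ y * transpose_mat K $$ (j, y))"
        using j K B by (auto simp: scalar_prod_def B_def intro!: sum.cong)
      also have "\<dots> = (K *\<^sub>v v) $ j"
        using j K v(1) by (simp add: Ksym scalar_prod_def mult.commute)
      finally show "(B * K) $$ (x, j) = 0\<^sub>m 1 q $$ (x, j)" using v(3) x j by simp
    qed (use B K in auto)
    have "mat_inner (B * G) (B * G) = mat_inner B (B * G * transpose_mat G)"
      by (rule mat_inner_mult_right[OF B G]) (use B G in simp)
    also have "B * G * transpose_mat G = B * K" unfolding K_def using B G by simp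
    also have "mat_inner B \<dots> = 0" unfolding BK mat_inner_def using B by simp
    finally have "B * G = 0\<^sub>m 1 m" using mat_inner_self_eq_0[of "B * G"] B G by simp
    then have B0: "B = 0\<^sub>m 1 q" using cancel[OF B] by simp
    have "v = 0\<^sub>v q"
    proof (rule eq_vecI)
      fix j assume "j < dim_vec (0\<^sub>v q :: real vec)"
      then have "j < q" by simp
      then have "v $ j = B $$ (0, j)" by (simp add: B_def)
      then show "v $ j = 0\<^sub>v q $ j" using \<open>j < q\<close> B0 by simp
    qed (use v in simp)
    with v(2) show False by simp
  qed
  from det_non_zero_imp_unit[OF K this, of "()"]
  obtain L where L: "L \<in> carrier_mat q q" and LK: "L * K = 1\<^sub>m q" and KL: "K * L = 1\<^sub>m q"
    unfolding Units_def ring_mat_def by auto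
  have Lsym: "transpose_mat L = L"
  proof -
    have "transpose_mat L * K = 1\<^sub>m q"
      using transpose_mult[OF K L] KL Ksym by simp
    moreover have "transpose_mat L * (K * L) = transpose_mat L * K * L"
      by (rule assoc_mult_mat[of _ q q _ q, symmetric]) (use L K in auto)
    ultimately show ?thesis using KL L by simp
  qed
  define B where "B = transpose_mat G * L"
  have B: "B \<in> carrier_mat m q" using G L by (simp add: B_def)
  have "G * B = G * transpose_mat G * L"
    unfolding B_def by (rule assoc_mult_mat[OF G GT L, symmetric])
  then have GB: "G * B = 1\<^sub>m q" using KL by (simp add: K_def)
  have "transpose_mat (B * G) = transpose_mat G * transpose_mat B"
    by (rule transpose_mult[OF B G])
  also have "transpose_mat B = L * G"
    unfolding B_def using transpose_mult[OF GT L] Lsym by simp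
  also have "transpose_mat G * (L * G) = B * G" unfolding B_def using G L by simp
  finally have sym: "transpose_mat (B * G) = B * G" .
  have "B * G * B = B * (G * B)" using B G by simp
  then have "is_pinv G B"
    unfolding is_pinv_def using B G GB sym by simp
  then show ?thesis
    unfolding pinv_def using is_pinv_unique by (blast intro: theI)
qed

section \<open>Orthogonal projections\<close>

lemma orth_proj_carrier [simp]:
  "dim_row (orth_proj S) = dim_row S" "dim_col (orth_proj S) = dim_row S"
  by (simp_all add: orth_proj_def)

lemma transpose_orth_proj [simp]: "transpose_mat (orth_proj S) = orth_proj S"
proof -
  have "S \<in> carrier_mat (dim_row S) (dim_col S)" by simp
  from transpose_mult[OF this, of "transpose_mat S" "dim_row S"] show ?thesis
    by (simp add: orth_proj_def)
qed

lemma orth_proj_stiefel_mult: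
  assumes "U \<in> stiefel p n"
  shows "orth_proj U * U = U"
proof -
  have U: "U \<in> carrier_mat n p" and UU: "transpose_mat U * U = 1\<^sub>m p"
    using assms by (auto simp: stiefel_def)
  have "orth_proj U * U = U * (transpose_mat U * U)"
    unfolding orth_proj_def by (rule assoc_mult_mat[of _ n p _ n]) (use U in auto)
  then show ?thesis using U UU by simp
qed

lemma orth_proj_idem:
  assumes "U \<in> stiefel p n"
  shows "orth_proj U * orth_proj U = orth_proj U"
proof -
  have U: "U \<in> carrier_mat n p" using assms by (simp add: stiefel_def)
  have "orth_proj U * (U * transpose_mat U) = orth_proj U * U * transpose_mat U"
    by (rule assoc_mult_mat[of _ n n _ p, symmetric]) (use U in \<open>auto simp: orth_proj_def\<close>)
  then show ?thesis by (simp only: orth_proj_stiefel_mult[OF assms]) (simp add: orth_proj_def)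
qed

lemma mat_rank_orth_proj_mult_le:
  assumes "U \<in> carrier_mat n p" "Z \<in> carrier_mat n m"
  shows "mat_rank (orth_proj U * Z) \<le> p"
proof -
  have "orth_proj U * Z = U * (transpose_mat U * Z)"
    unfolding orth_proj_def by (rule assoc_mult_mat[of _ n p _ n]) (use assms in auto)
  then show ?thesis using mat_rank_mult_le[of U n p "transpose_mat U * Z" m] assms by simp
qed

lemma stiefel_take_cols:
  assumes W: "W \<in> stiefel m m" and p: "p \<le> m"
  shows "mat_of_cols m (take p (cols W)) \<in> stiefel p m"
proof -
  let ?U = "mat_of_cols m (take p (cols W))"
  have Wc: "W \<in> carrier_mat m m" and WW: "transpose_mat W * W = 1\<^sub>m m"
    using W by (auto simp: stiefel_def)
  have len: "length (take p (cols W)) = p" using Wc p by simp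
  have col: "col ?U j = col W j" if "j < p" for j
    using that Wc p by (subst col_mat_of_cols) auto
  have "transpose_mat ?U * ?U = 1\<^sub>m p"
  proof (rule eq_matI)
    fix i j assume "i < dim_row (1\<^sub>m p :: real mat)" "j < dim_col (1\<^sub>m p :: real mat)"
    then have i: "i < p" and j: "j < p" by auto
    have "(transpose_mat ?U * ?U) $$ (i, j) = (transpose_mat W * W) $$ (i, j)"
      using i j p Wc len by (simp add: col)
    then show "(transpose_mat ?U * ?U) $$ (i, j) = 1\<^sub>m p $$ (i, j)" using WW i j p by simp
  qed (use len in auto)
  moreover have "?U \<in> carrier_mat m p" using mat_of_cols_carrier(1)[of m "take p (cols W)"] len by simp
  ultimately show ?thesis by (simp add: stiefel_def)
qed

lemma hcat_carrier:
  assumes "U \<in> carrier_mat n p" "V \<in> carrier_mat n s"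
  shows "hcat U V \<in> carrier_mat n (p + s)"
  using assms by (simp add: hcat_def mat_of_cols_def)

lemma orth_proj_hcat:
  assumes U: "U \<in> carrier_mat n p" and V: "V \<in> carrier_mat n s"
  shows "orth_proj (hcat U V) = orth_proj U + orth_proj V"
proof (rule eq_matI)
  note S = hcat_carrier[OF assms]
  fix x y assume "x < dim_row (orth_proj U + orth_proj V)" "y < dim_col (orth_proj U + orth_proj V)"
  then have x: "x < n" and y: "y < n" using V by (auto simp: orth_proj_def)
  have en: "hcat U V $$ (z, c) = (if c < p then U $$ (z, c) else V $$ (z, c - p))"
    if "z < n" "c < p + s" for z c
    using that U V by (auto simp: hcat_def mat_of_cols_def nth_append)
  have split: "(\<Sum>c<p + s. h c) = (\<Sum>c<p. h c) + (\<Sum>c<s. h (p + c))" for h :: "nat \<Rightarrow> real"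
    by (induction s) auto
  have "orth_proj (hcat U V) $$ (x, y)
      = (\<Sum>c<p + s. hcat U V $$ (x, c) * hcat U V $$ (y, c))"
    using S x y by (auto simp: orth_proj_def scalar_prod_def atLeast0LessThan intro!: sum.cong)
  also have "\<dots> = (\<Sum>c<p. hcat U V $$ (x, c) * hcat U V $$ (y, c))
      + (\<Sum>c<s. hcat U V $$ (x, p + c) * hcat U V $$ (y, p + c))"
    by (rule split)
  also have "\<dots> = orth_proj U $$ (x, y) + orth_proj V $$ (x, y)"
    using U V x y by (simp add: en orth_proj_def scalar_prod_def atLeast0LessThan)
  also have "\<dots> = (orth_proj U + orth_proj V) $$ (x, y)"
    using V x y by (simp add: orth_proj_def)
  finally show "orth_proj (hcat U V) $$ (x, y) = (orth_proj U + orth_proj V) $$ (x, y)" .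
qed (use assms hcat_carrier[OF assms] in \<open>auto simp: orth_proj_def\<close>)

text \<open>
  Orthogonality of the two blocks makes \<open>orth_proj U + orth_proj V\<close> the projection onto the sum of
  the two column spaces.
\<close>

lemma orth_proj_hcat_facts:
  assumes U: "U \<in> stiefel p n" and V: "V \<in> stiefel s n" and UV: "transpose_mat U * V = 0\<^sub>m p s"
  shows "orth_proj (hcat U V) * U = U"
    and "orth_proj (hcat U V) * orth_proj (hcat U V) = orth_proj (hcat U V)"
proof -
  let ?P = "orth_proj (hcat U V)"
  have Uc: "U \<in> carrier_mat n p" and Vc: "V \<in> carrier_mat n s"
    and UU: "transpose_mat U * U = 1\<^sub>m p" and VV: "transpose_mat V * V = 1\<^sub>m s"
    using U V by (auto simp: stiefel_def)
  have VU: "transpose_mat V * U = 0\<^sub>m s p"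
    using transpose_mult[of "transpose_mat U" p n V s] UV Uc Vc by simp
  have P: "?P \<in> carrier_mat n n" using hcat_carrier[OF Uc Vc] by (simp add: orth_proj_def)
  have pU: "orth_proj U \<in> carrier_mat n n" and pV: "orth_proj V \<in> carrier_mat n n"
    using Uc Vc by (auto simp: orth_proj_def)
  have "?P * U = U * (transpose_mat U * U) + V * (transpose_mat V * U)"
    unfolding orth_proj_hcat[OF Uc Vc] add_mult_distrib_mat[OF pU pV Uc]
    unfolding orth_proj_def using Uc Vc
    by (simp add: assoc_mult_mat[of _ n p _ n] assoc_mult_mat[of _ n s _ n])
  then show PU: "?P * U = U" using Uc Vc UU VU by simp
  have "?P * V = U * (transpose_mat U * V) + V * (transpose_mat V * V)"
    unfolding orth_proj_hcat[OF Uc Vc] add_mult_distrib_mat[OF pU pV Vc]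
    unfolding orth_proj_def using Uc Vc
    by (simp add: assoc_mult_mat[of _ n p _ n] assoc_mult_mat[of _ n s _ n])
  then have PV: "?P * V = V" using Uc Vc VV UV by simp
  have "?P * ?P = ?P * orth_proj U + ?P * orth_proj V"
    by (subst (2) orth_proj_hcat[OF Uc Vc]) (rule mult_add_distrib_mat[OF P pU pV])
  also have "?P * orth_proj U = orth_proj U"
    unfolding orth_proj_def[of U] using PU P Uc by (simp add: assoc_mult_mat[symmetric, of _ n n _ p])
  also have "?P * orth_proj V = orth_proj V"
    unfolding orth_proj_def[of V] using PV P Vc by (simp add: assoc_mult_mat[symmetric, of _ n n _ s])
  finally show "?P * ?P = ?P" by (simp add: orth_proj_hcat[OF Uc Vc])
qed

lemma orth_proj_compl_facts:
  assumes S: "S \<in> carrier_mat n p" and idem: "orth_proj S * orth_proj S = orth_proj S"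
  shows "orth_proj_compl S \<in> carrier_mat n n"
    and "transpose_mat (orth_proj_compl S) = orth_proj_compl S"
    and "orth_proj_compl S * orth_proj_compl S = orth_proj_compl S"
    and "orth_proj S * orth_proj_compl S = 0\<^sub>m n n"
proof -
  let ?P = "orth_proj S" and ?R = "orth_proj_compl S"
  have P: "?P \<in> carrier_mat n n" using S by (simp add: orth_proj_def)
  have R_def: "?R = 1\<^sub>m n - ?P" using S by (simp add: orth_proj_def orth_proj_compl_def)
  show R: "?R \<in> carrier_mat n n" unfolding R_def by (rule minus_carrier_mat[OF P])
  show "transpose_mat ?R = ?R" unfolding R_def transpose_minus[OF one_carrier_mat P] by simp
  have "?P * ?R = ?P * 1\<^sub>m n - ?P * ?P"
    unfolding R_def by (rule mult_minus_distrib_mat[OF P one_carrier_mat P])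
  then have "?P * ?R = ?P - ?P" using right_mult_one_mat[OF P] idem by simp
  also have "\<dots> = 0\<^sub>m n n" using P by (intro eq_matI) auto
  finally show PR: "?P * ?R = 0\<^sub>m n n" .
  have "?R * ?R = 1\<^sub>m n * ?R - ?P * ?R"
    using minus_mult_distrib_mat[OF one_carrier_mat P R] by (simp add: R_def)
  also have "\<dots> = ?R - 0\<^sub>m n n" using PR left_mult_one_mat[OF R] by simp
  also have "\<dots> = ?R" using R by (intro eq_matI) auto
  finally show "?R * ?R = ?R" .
qed

section \<open>Mode products\<close>

lemma unfolding_mat_carrier:
  "unfolding_mat n k X \<in> carrier_mat (n ! k) (prod_list (delete_at k n))"
  by (simp add: unfolding_mat_def)

lemma mode_prod_in_tensors [simp]: "mode_prod n k A X \<in> tensors (n[k := dim_row A])"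
  by (simp add: mode_prod_def folding_def)

lemma insert_at_delete_at_update: "k < length i \<Longrightarrow> insert_at k y (delete_at k i) = i[k := y]"
  by (simp add: insert_at_def delete_at_def upd_conv_take_nth_drop min_def)

text \<open>
  The entrywise form is used only for the commutation of products along different modes;
  everything within a single mode is matrix algebra on the unfolding.
\<close>

lemma entry_mode_prod:
  assumes k: "k < length n" and A: "dim_col A = n ! k" and i: "i \<in> indices (n[k := dim_row A])"
  shows "entry (mode_prod n k A X) i = (\<Sum>y<n ! k. A $$ (i ! k, y) * entry X (i[k := y]))"
proof -
  let ?m = "delete_at k n"
  have ik: "k < length i" "i ! k < dim_row A" using k i by (auto simp: indices_def)
  have d: "delete_at k i \<in> indices ?m" using delete_at_in_indices[OF i, of k] by simp
  note l = multi_lin_index[OF d]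
  have "entry (mode_prod n k A X) i
      = (A * unfolding_mat n k X) $$ (i ! k, lin_index ?m (delete_at k i))"
    using i by (simp add: mode_prod_def folding_def tensor_of.rep_eq)
  also have "\<dots> = (\<Sum>y<n ! k. A $$ (i ! k, y) * unfolding_mat n k X $$ (y, lin_index ?m (delete_at k i)))"
    using ik l A by (auto simp: scalar_prod_def unfolding_mat_def atLeast0LessThan)
  also have "\<dots> = (\<Sum>y<n ! k. A $$ (i ! k, y) * entry X (i[k := y]))"
    using ik l by (intro sum.cong) (auto simp: unfolding_mat_def insert_at_delete_at_update)
  finally show ?thesis .
qed

lemma indices_update:
  "i \<in> indices (n[j := b]) \<Longrightarrow> y < n ! j \<Longrightarrow> i[j := y] \<in> indices n"
  by (cases "j < length n") (auto simp: indices_def nth_list_update split: if_splits)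

lemma mode_prod_commute:
  assumes jk: "j \<noteq> k" "j < length n" "k < length n" and A: "dim_col A = n ! j" and B: "dim_col B = n ! k"
  shows "mode_prod (n[j := dim_row A]) k B (mode_prod n j A X)
       = mode_prod (n[k := dim_row B]) j A (mode_prod n k B X)"
proof (rule tensor_eqI)
  fix i
  let ?n = "n[j := dim_row A, k := dim_row B]"
  have sw: "?n = n[k := dim_row B, j := dim_row A]" using jk by (simp add: list_update_swap)
  show "entry (mode_prod (n[j := dim_row A]) k B (mode_prod n j A X)) i
      = entry (mode_prod (n[k := dim_row B]) j A (mode_prod n k B X)) i"
  proof (cases "i \<in> indices ?n")
    case True
    then have len: "length i = length n" by (simp add: indices_def)
    have 1: "entry (mode_prod n j A X) (i[k := y])
        = (\<Sum>z<n ! j. A $$ (i ! j, z) * entry X (i[k := y, j := z]))" if "y < n ! k" for y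
      using that True jk A by (subst entry_mode_prod) (auto intro: indices_update)
    have 2: "entry (mode_prod n k B X) (i[j := z])
        = (\<Sum>y<n ! k. B $$ (i ! k, y) * entry X (i[j := z, k := y]))" if "z < n ! j" for z
      using that True jk B sw by (subst entry_mode_prod) (auto intro: indices_update)
    have "entry (mode_prod (n[j := dim_row A]) k B (mode_prod n j A X)) i
        = (\<Sum>y<n ! k. B $$ (i ! k, y) * (\<Sum>z<n ! j. A $$ (i ! j, z) * entry X (i[k := y, j := z])))"
      using True jk B by (subst entry_mode_prod) (auto simp: 1)
    also have "\<dots> = (\<Sum>z<n ! j. A $$ (i ! j, z) * (\<Sum>y<n ! k. B $$ (i ! k, y) * entry X (i[j := z, k := y])))"
      unfolding sum_distrib_left
      by (subst sum.swap) (use jk in \<open>auto intro!: sum.cong simp: list_update_swap\<close>)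
    also have "\<dots> = entry (mode_prod (n[k := dim_row B]) j A (mode_prod n k B X)) i"
      using True jk A sw by (subst entry_mode_prod) (auto simp: 2)
    finally show ?thesis .
  next
    case False
    then show ?thesis
      using mode_prod_in_tensors[of "n[j := dim_row A]" k B "mode_prod n j A X"]
        mode_prod_in_tensors[of "n[k := dim_row B]" j A "mode_prod n k B X"] sw
      unfolding tensors_def by auto
  qed
qed

lemma mode_prod_mult:
  assumes "k < length n" "dim_col A = n ! k" "dim_col B = dim_row A"
  shows "mode_prod (n[k := dim_row A]) k B (mode_prod n k A X) = mode_prod n k (B * A) X"
proof -
  have "B * (A * unfolding_mat n k X) = B * A * unfolding_mat n k X"
    by (rule assoc_mult_mat[symmetric]) (use assms unfolding_mat_carrier[of n k X] in auto)
  then show ?thesis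
    unfolding mode_prod_def[of "n[k := dim_row A]"] unfolding_mat_mode_prod[OF assms(1)]
    by (simp add: mode_prod_def)
qed

lemma mode_prod_eq_0:
  assumes "A * unfolding_mat n k X = 0\<^sub>m (dim_row A) (prod_list (delete_at k n))" "k < length n"
  shows "mode_prod n k A X = 0"
proof (rule tensor_eqI)
  fix i
  show "entry (mode_prod n k A X) i = entry 0 i"
  proof (cases "i \<in> indices (n[k := dim_row A])")
    case True
    then have "i ! k < dim_row A" using assms(2) by (auto simp: indices_def)
    moreover have "lin_index (delete_at k n) (delete_at k i) < prod_list (delete_at k n)"
      using multi_lin_index delete_at_in_indices[OF True, of k] by simp
    ultimately show ?thesis using True
      by (simp add: mode_prod_def folding_def tensor_of.rep_eq assms(1) zero_tensor.rep_eq)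
  qed (simp add: mode_prod_def folding_def tensor_of.rep_eq zero_tensor.rep_eq)
qed

lemma mode_prod_0 [simp]: "k < length n \<Longrightarrow> dim_col A = n ! k \<Longrightarrow> mode_prod n k A 0 = 0"
proof (rule mode_prod_eq_0)
  assume "k < length n" "dim_col A = n ! k"
  moreover have "unfolding_mat n k 0 = 0\<^sub>m (n ! k) (prod_list (delete_at k n))"
    by (intro eq_matI) (auto simp: unfolding_mat_def zero_tensor.rep_eq)
  ultimately show "A * unfolding_mat n k 0 = 0\<^sub>m (dim_row A) (prod_list (delete_at k n))"
    by simp
qed

lemma unfolding_mat_invariant:
  assumes "mode_prod n k P X = X" "k < length n" "dim_row P = n ! k"
  shows "unfolding_mat n k X = P * unfolding_mat n k X"
  using unfolding_mat_mode_prod[OF assms(2), of P X] assms by simp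

text \<open>
  The unfolding is a bijective rearrangement of the entries.
\<close>

lemma inner_eq_mat_inner:
  assumes k: "k < length n" and X: "X \<in> tensors n"
  shows "inner X Y = mat_inner (unfolding_mat n k X) (unfolding_mat n k Y)"
proof -
  let ?m = "delete_at k n"
  let ?g = "\<lambda>(x, j). insert_at k x (multi_index ?m j)"
  have len: "k \<le> length ?m" using k by (simp add: length_delete_at)
  have "inner X Y = (\<Sum>i\<in>indices n. entry X i * entry Y i)"
    by (rule inner_tensor_superset) (use X in \<open>auto simp: tensors_def\<close>)
  also have "\<dots> = (\<Sum>p\<in>{..<n ! k} \<times> {..<prod_list ?m}. entry X (?g p) * entry Y (?g p))"
  proof (rule sum.reindex_bij_witness[of _ ?g "\<lambda>i. (i ! k, lin_index ?m (delete_at k i))"])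
    fix i assume i: "i \<in> indices n"
    have ik: "k < length i" "i ! k < n ! k" using i k by (auto simp: indices_def)
    note l = multi_lin_index[OF delete_at_in_indices[OF i, of k]]
    show "?g (i ! k, lin_index ?m (delete_at k i)) = i" using l ik by simp
    show "(i ! k, lin_index ?m (delete_at k i)) \<in> {..<n ! k} \<times> {..<prod_list ?m}" using l ik by simp
    show "entry X (?g (i ! k, lin_index ?m (delete_at k i))) * entry Y (?g (i ! k, lin_index ?m (delete_at k i)))
      = entry X i * entry Y i" using l ik by simp
  next
    fix p assume "p \<in> {..<n ! k} \<times> {..<prod_list ?m}"
    then obtain x j where p: "p = (x, j)" "x < n ! k" "j < prod_list ?m" by auto
    show "(?g p ! k, lin_index ?m (delete_at k (?g p))) = p"
      using p len by (simp add: lin_multi_index)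
    show "?g p \<in> indices n"
      using p k by (simp add: insert_at_in_indices multi_index_in_indices)
  qed
  also have "\<dots> = mat_inner (unfolding_mat n k X) (unfolding_mat n k Y)"
    by (simp add: sum.cartesian_product mat_inner_def unfolding_mat_def case_prod_unfold)
  finally show ?thesis .
qed

text \<open>
  In the unfolding along mode k, this is the adjoint of a matrix product.
\<close>

lemma mode_prod_adjoint:
  assumes k: "k < length n" and A: "dim_col A = n ! k"
  shows "inner (mode_prod n k A X) Y = inner X (mode_prod (n[k := dim_row A]) k (transpose_mat A) Y)"
proof -
  let ?n = "n[k := dim_row A]"
  have nA: "?n[k := dim_row (transpose_mat A)] = n" using A by simp
  have k': "k < length ?n" using k by simp
  have Xc: "unfolding_mat n k X \<in> carrier_mat (n ! k) (prod_list (delete_at k n))"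
    and Yc: "unfolding_mat ?n k Y \<in> carrier_mat (dim_row A) (prod_list (delete_at k n))"
    and Ac: "A \<in> carrier_mat (dim_row A) (n ! k)"
    using unfolding_mat_carrier[of n k X] unfolding_mat_carrier[of ?n k Y] k A by auto
  have "inner (mode_prod n k A X) Y = mat_inner (A * unfolding_mat n k X) (unfolding_mat ?n k Y)"
    unfolding unfolding_mat_mode_prod[OF k, symmetric]
    by (rule inner_eq_mat_inner[OF k' mode_prod_in_tensors])
  also have "\<dots> = mat_inner (unfolding_mat n k X) (transpose_mat A * unfolding_mat ?n k Y)"
    by (rule mat_inner_mult_left[OF Ac Xc Yc])
  also have "\<dots> = mat_inner (transpose_mat A * unfolding_mat ?n k Y) (unfolding_mat n k X)"
    by (rule mat_inner_commute[OF Xc mult_carrier_mat[OF transpose_carrier_mat[THEN iffD2, OF Ac] Yc]])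
  also have "\<dots> = inner (mode_prod ?n k (transpose_mat A) Y) X"
    using inner_eq_mat_inner[OF k mode_prod_in_tensors[of ?n k "transpose_mat A" Y, unfolded nA], of X]
      unfolding_mat_mode_prod[OF k', of "transpose_mat A" Y, unfolded nA] by simp
  finally show ?thesis by (simp add: inner_commute)
qed

section \<open>Products along several modes\<close>

fun result_size :: "nat list \<Rightarrow> (nat \<times> real mat) list \<Rightarrow> nat list" where
  "result_size n [] = n"
| "result_size n ((k, A) # ps) = result_size (n[k := dim_row A]) ps"

text \<open>
  Distinctness of the modes is part of the notion because only then do the factors commute.
\<close>

definition compatible :: "nat list \<Rightarrow> (nat \<times> real mat) list \<Rightarrow> bool" where
  "compatible n ps \<longleftrightarrow>
     distinct (map fst ps) \<and> (\<forall>(k, A)\<in>set ps. k < length n \<and> dim_col A = n ! k)"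

lemma compatible_Nil [simp]: "compatible n []"
  by (simp add: compatible_def)

lemma compatible_Cons:
  "compatible n ((k, A) # ps) \<longleftrightarrow>
     k < length n \<and> dim_col A = n ! k \<and> k \<notin> fst ` set ps \<and> compatible (n[k := dim_row A]) ps"
  by (force simp: compatible_def nth_list_update)

lemma compatible_map:
  "compatible n (map (\<lambda>k. (k, F k)) ks) \<longleftrightarrow> distinct ks \<and> (\<forall>k\<in>set ks. k < length n \<and> dim_col (F k) = n ! k)"
  by (auto simp: compatible_def comp_def)

lemma length_result_size [simp]: "length (result_size n ps) = length n"
  by (induction n ps rule: result_size.induct) auto

lemma result_size_nth_other: "k \<notin> fst ` set ps \<Longrightarrow> result_size n ps ! k = n ! k"
  by (induction n ps rule: result_size.induct) auto

lemma result_size_nth: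
  "compatible n ps \<Longrightarrow> (k, A) \<in> set ps \<Longrightarrow> result_size n ps ! k = dim_row A"
  by (induction n ps rule: result_size.induct) (auto simp: compatible_Cons result_size_nth_other)

lemma result_size_eqI:
  assumes "compatible n ps" "length m = length n"
    and "\<And>k A. (k, A) \<in> set ps \<Longrightarrow> dim_row A = m ! k"
    and "\<And>k. k < length n \<Longrightarrow> k \<notin> fst ` set ps \<Longrightarrow> n ! k = m ! k"
  shows "result_size n ps = m"
proof (rule nth_equalityI)
  fix k assume "k < length (result_size n ps)"
  then show "result_size n ps ! k = m ! k"
    using assms(3,4) result_size_nth[OF assms(1)] result_size_nth_other[of k ps n]
    by (cases "k \<in> fst ` set ps") auto
qed (simp add: assms(2))

lemma mode_prods_in_tensors:
  "X \<in> tensors n \<or> ps \<noteq> [] \<Longrightarrow> mode_prods n X ps \<in> tensors (result_size n ps)"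
  by (induction n X ps rule: mode_prods.induct) auto

lemma mode_prods_0: "compatible n ps \<Longrightarrow> mode_prods n 0 ps = 0"
  by (induction n ps rule: result_size.induct) (auto simp: compatible_Cons)

lemma mode_prod_mode_prods_other:
  assumes "compatible n ps" "k \<notin> fst ` set ps" "k < length n" "dim_col B = n ! k"
  shows "mode_prod (result_size n ps) k B (mode_prods n X ps)
       = mode_prods (n[k := dim_row B]) (mode_prod n k B X) ps"
  using assms
proof (induction n X ps rule: mode_prods.induct)
  case (2 n X j A ps)
  then have jk: "j \<noteq> k" "j < length n" "dim_col A = n ! j" by (auto simp: compatible_Cons)
  have "mode_prod (result_size (n[j := dim_row A]) ps) k B (mode_prods (n[j := dim_row A]) (mode_prod n j A X) ps)
      = mode_prods (n[j := dim_row A, k := dim_row B]) (mode_prod (n[j := dim_row A]) k B (mode_prod n j A X)) ps"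
    using "2.prems" by (intro "2.IH") (auto simp: compatible_Cons)
  also have "mode_prod (n[j := dim_row A]) k B (mode_prod n j A X)
      = mode_prod (n[k := dim_row B]) j A (mode_prod n k B X)"
    using jk "2.prems" by (intro mode_prod_commute) auto
  finally show ?case using jk by (simp add: list_update_swap[of j k])
qed simp

text \<open>
  A further factor in mode k commutes past the factors of the other modes and merges with the
  factor A that is already there.
\<close>

lemma mode_prod_mode_prods_same:
  assumes "compatible n ps" "(k, A) \<in> set ps" "dim_col B = dim_row A"
  shows "mode_prod (result_size n ps) k B (mode_prods n X ps)
       = mode_prods n X (map (\<lambda>(j, C). (j, if j = k then B * C else C)) ps)"
  using assms
proof (induction n X ps rule: mode_prods.induct)
  case (2 n X j C ps)
  note comp = "2.prems"(1)[unfolded compatible_Cons]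
  show ?case
  proof (cases "j = k")
    case True
    have CA: "C = A" using "2.prems"(2) comp True by force
    have same: "map (\<lambda>(j, C). (j, if j = k then B * C else C)) ps = ps"
      using comp True by (intro map_idI) force
    have "mode_prod (result_size (n[k := dim_row C]) ps) k B (mode_prods (n[k := dim_row C]) (mode_prod n k C X) ps)
        = mode_prods (n[k := dim_row C, k := dim_row B]) (mode_prod (n[k := dim_row C]) k B (mode_prod n k C X)) ps"
      using comp True CA "2.prems"(3) by (intro mode_prod_mode_prods_other) auto
    also have "mode_prod (n[k := dim_row C]) k B (mode_prod n k C X) = mode_prod n k (B * C) X"
      using comp True CA "2.prems"(3) by (intro mode_prod_mult) auto
    finally show ?thesis using True same by simp
  next
    case False
    then show ?thesis using "2.IH" "2.prems" comp by simp
  qed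
qed simp

lemma mode_prod_mode_prods_absorb:
  assumes "compatible n ps" "(k, A) \<in> set ps" "dim_col B = dim_row A" "B * A = A"
  shows "mode_prod (result_size n ps) k B (mode_prods n X ps) = mode_prods n X ps"
proof -
  have "map (\<lambda>(j, C). (j, if j = k then B * C else C)) ps = ps"
  proof (rule map_idI)
    fix p assume p: "p \<in> set ps"
    obtain j C where jC: "p = (j, C)" by (cases p)
    have "C = A" if "j = k"
      using assms(1,2) p jC that unfolding compatible_def by (auto dest: eq_key_imp_eq_value)
    then show "(\<lambda>(j, C). (j, if j = k then B * C else C)) p = p" using jC assms(4) by auto
  qed
  then show ?thesis using mode_prod_mode_prods_same[OF assms(1-3)] by simp
qed

text \<open>
  Factors commute, so that one vanishing product \<open>A * unfolding_mat n k X\<close> annihilates everything.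
\<close>

lemma mode_prods_eq_0:
  assumes "compatible n ps" "(k, A) \<in> set ps"
    and "A * unfolding_mat n k X = 0\<^sub>m (dim_row A) (prod_list (delete_at k n))"
  shows "mode_prods n X ps = 0"
  using assms
proof (induction n X ps rule: mode_prods.induct)
  case (2 n X j C ps)
  note comp = "2.prems"(1)[unfolded compatible_Cons]
  have k: "k < length n" "dim_col A = n ! k" using "2.prems"(1,2) by (auto simp: compatible_def)
  show ?case
  proof (cases "j = k")
    case True
    have "C = A" using "2.prems"(2) comp True by force
    then have "mode_prod n j C X = 0" using mode_prod_eq_0 "2.prems"(3) k True by simp
    then show ?thesis using comp by (simp add: mode_prods_0)
  next
    case False
    let ?n = "n[j := dim_row C]"
    have "mode_prod ?n k A (mode_prod n j C X) = mode_prod (n[k := dim_row A]) j C (mode_prod n k A X)"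
      using comp k False by (intro mode_prod_commute) auto
    also have "mode_prod n k A X = 0" using mode_prod_eq_0 "2.prems"(3) k by simp
    also have "mode_prod (n[k := dim_row A]) j C 0 = 0" using comp k False by simp
    finally have 0: "mode_prod ?n k A (mode_prod n j C X) = 0" .
    have "A * unfolding_mat ?n k (mode_prod n j C X)
        = unfolding_mat (?n[k := dim_row A]) k (mode_prod ?n k A (mode_prod n j C X))"
      using k by (simp add: unfolding_mat_mode_prod)
    also have "\<dots> = 0\<^sub>m (dim_row A) (prod_list (delete_at k ?n))"
      unfolding 0 using k by (intro eq_matI) (auto simp: unfolding_mat_def zero_tensor.rep_eq)
    finally show ?thesis using "2.IH" "2.prems" comp False by simp
  qed
qed simp

lemma compatible_transpose:
  assumes "compatible n ps"
  shows "compatible (result_size n ps) (map (\<lambda>(k, A). (k, transpose_mat A)) ps)"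
proof -
  have "map fst (map (\<lambda>(k, A). (k, transpose_mat A)) ps) = map fst ps" by (induction ps) auto
  then have "distinct (map fst (map (\<lambda>(k, A). (k, transpose_mat A)) ps))"
    using assms unfolding compatible_def by metis
  moreover have "k < length n \<and> dim_col (transpose_mat A) = result_size n ps ! k" if "(k, A) \<in> set ps" for k A
    using that assms result_size_nth[OF assms that] by (auto simp: compatible_def)
  ultimately show ?thesis
    unfolding compatible_def by auto
qed

text \<open>
  The adjoint of a composition reverses the order of the factors; since they commute, the given
  order may be kept.
\<close>

lemma mode_prods_adjoint:
  assumes "compatible n ps"
  shows "inner (mode_prods n X ps) Y
       = inner X (mode_prods (result_size n ps) Y (map (\<lambda>(k, A). (k, transpose_mat A)) ps))"
  using assms
proof (induction n X ps rule: mode_prods.induct)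
  case (2 n X k A ps)
  note comp = "2.prems"[unfolded compatible_Cons]
  let ?n = "n[k := dim_row A]" and ?qs = "map (\<lambda>(k, A). (k, transpose_mat A)) ps"
  let ?N = "result_size ?n ps"
  have qs: "compatible ?N ?qs" "k \<notin> fst ` set ?qs"
    using comp compatible_transpose[of ?n ps] by force+
  have size_back: "result_size ?N ?qs = ?n"
  proof (rule nth_equalityI)
    fix j assume "j < length (result_size ?N ?qs)"
    show "result_size ?N ?qs ! j = ?n ! j"
    proof (cases "j \<in> fst ` set ps")
      case True
      then obtain C where C: "(j, C) \<in> set ps" by auto
      then have "(j, transpose_mat C) \<in> set ?qs" by force
      from result_size_nth[OF qs(1) this] C comp show ?thesis
        by (auto simp: compatible_def)
    next
      case False
      then have "j \<notin> fst ` set ?qs" by force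
      then show ?thesis using False by (simp add: result_size_nth_other)
    qed
  qed simp
  have Nk: "?N ! k = dim_row A" using comp by (simp add: result_size_nth_other)
  have "inner (mode_prods ?n (mode_prod n k A X) ps) Y = inner (mode_prod n k A X) (mode_prods ?N Y ?qs)"
    using "2.IH" comp by simp
  also have "\<dots> = inner X (mode_prod ?n k (transpose_mat A) (mode_prods ?N Y ?qs))"
    using comp by (intro mode_prod_adjoint) auto
  also have "mode_prod ?n k (transpose_mat A) (mode_prods ?N Y ?qs)
      = mode_prods (?N[k := dim_row (transpose_mat A)]) (mode_prod ?N k (transpose_mat A) Y) ?qs"
    using mode_prod_mode_prods_other[OF qs, of "transpose_mat A" Y] comp Nk unfolding size_back by simp
  finally show ?case by simp
qed simp

text \<open>
  Each factor with orthonormal columns is an isometry of tensors.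
\<close>

lemma mode_prods_isometry:
  assumes "compatible n ps" "X \<in> tensors n"
    and "\<And>k A. (k, A) \<in> set ps \<Longrightarrow> transpose_mat A * A = 1\<^sub>m (dim_col A)"
  shows "inner (mode_prods n X ps) (mode_prods n X ps) = inner X X"
  using assms
proof (induction n X ps rule: mode_prods.induct)
  case (2 n X k A ps)
  note comp = "2.prems"(1)[unfolded compatible_Cons]
  have "inner (mode_prods n X ((k, A) # ps)) (mode_prods n X ((k, A) # ps))
      = inner (mode_prod n k A X) (mode_prod n k A X)"
    unfolding mode_prods.simps using comp "2.prems"(3) by (intro "2.IH") auto
  also have "\<dots> = inner X (mode_prod (n[k := dim_row A]) k (transpose_mat A) (mode_prod n k A X))"
    using comp by (intro mode_prod_adjoint) auto
  also have "mode_prod (n[k := dim_row A]) k (transpose_mat A) (mode_prod n k A X)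
      = mode_prod n k (1\<^sub>m (n ! k)) X"
    using comp "2.prems"(3)[of k A] by (subst mode_prod_mult) auto
  also have "\<dots> = X"
    using comp folding_unfolding_mat[of k n X] "2.prems"(2)
      left_mult_one_mat[OF unfolding_mat_carrier[of n k X]]
    by (simp add: mode_prod_def)
  finally show ?case .
qed simp

section \<open>The range of the HOSVD projection\<close>

text \<open>
  The result Y is fixed by the projection \<open>U k * (U k)\<^sup>T\<close> in mode k, because this projection is
  idempotent and commutes with the ones in the other modes. So the unfolding of Y in mode k factors
  through the \<open>r ! k\<close> columns of \<open>U k\<close>.
\<close>

lemma hosvd_proj_in_tucker_variety:
  assumes n: "n \<noteq> []" "length r = length n" "\<forall>k<length n. r ! k \<le> n ! k"
    and Y: "is_hosvd_proj n r A Y"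
  shows "Y \<in> tucker_variety n r"
proof -
  obtain U where U: "\<forall>k<length n. leading_left_singular (r ! k) (unfolding_mat n k A) (U k)"
    and Y: "Y = mode_prods n A (map (\<lambda>k. (k, orth_proj (U k))) (modes n))"
    using Y unfolding is_hosvd_proj_def by blast
  let ?ps = "map (\<lambda>k. (k, orth_proj (U k))) (modes n)"
  have St: "U k \<in> stiefel (r ! k) (n ! k)" if kn: "k < length n" for k
  proof -
    have row: "dim_row (unfolding_mat n k A) = n ! k" by (simp add: unfolding_mat_def)
    obtain W D V where W: "is_svd (unfolding_mat n k A) W D V"
      and Uk: "U k = mat_of_cols (n ! k) (take (r ! k) (cols W))"
      using U[rule_format, OF kn] unfolding leading_left_singular_def row by blast
    have "W \<in> stiefel (n ! k) (n ! k)" using W unfolding is_svd_def row by blast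
    then show ?thesis unfolding Uk using n(3) kn by (intro stiefel_take_cols) auto
  qed
  have dim: "dim_row (U k) = n ! k" if "k < length n" for k
    using St[OF that] by (auto simp: stiefel_def)
  have comp: "compatible n ?ps" by (auto simp: compatible_map dim)
  have size: "result_size n ?ps = n" by (rule result_size_eqI[OF comp]) (auto simp: dim)
  have "Y \<in> tensors n" unfolding Y using mode_prods_in_tensors[of A n ?ps] size n(1) by simp
  moreover have "mat_rank (unfolding_mat n k Y) \<le> r ! k" if k: "k < length n" for k
  proof -
    have "mode_prod (result_size n ?ps) k (orth_proj (U k)) (mode_prods n A ?ps) = mode_prods n A ?ps"
      by (rule mode_prod_mode_prods_absorb[OF comp]) (use k orth_proj_idem[OF St[OF k]] in auto)
    then have "mode_prod n k (orth_proj (U k)) Y = Y" by (simp only: size Y)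
    then have "unfolding_mat n k Y = orth_proj (U k) * unfolding_mat n k Y"
      by (rule unfolding_mat_invariant) (use k dim in auto)
    moreover have "mat_rank (orth_proj (U k) * unfolding_mat n k Y) \<le> r ! k"
      by (rule mat_rank_orth_proj_mult_le) (use St[OF k] unfolding_mat_carrier in \<open>auto simp: stiefel_def\<close>)
    ultimately show ?thesis by simp
  qed
  ultimately show ?thesis
    using n(2) by (simp add: tucker_variety_def list_all2_conv_all_nth rank_tc_def)
qed

section \<open>Cores of Tucker decompositions\<close>

lemma tucker_decomp_facts:
  assumes "tucker_decomp n X q G U"
  shows "length q = length n"
    and "\<And>k. k < length n \<Longrightarrow> U k \<in> carrier_mat (n ! k) (q ! k)"
    and "\<And>k. k < length n \<Longrightarrow> transpose_mat (U k) * U k = 1\<^sub>m (q ! k)"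
    and "\<And>k. k < length n \<Longrightarrow> mat_rank (unfolding_mat n k X) = q ! k"
    and "\<And>k. k < length n \<Longrightarrow> dim_row (U k) = n ! k"
    and "\<And>k. k < length n \<Longrightarrow> dim_col (U k) = q ! k"
  using assms by (auto simp: tucker_decomp_def stiefel_def rank_tc_def)

text \<open>
  The multilinear rank of X equals the size q of its core. A linear relation among the rows of a
  core unfolding would make the unfolding of X, which is \<open>U k * Z\<close> with the same relation among the
  rows of Z, of rank less than \<open>q ! k\<close>.
\<close>

lemma tucker_core_row_independent:
  assumes T: "tucker_decomp n X q G U" and k: "k < length n"
    and B: "B \<in> carrier_mat 1 (q ! k)"
    and BG: "B * unfolding_mat q k G = 0\<^sub>m 1 (prod_list (delete_at k q))"
  shows "B = 0\<^sub>m 1 (q ! k)"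
proof (rule ccontr)
  assume nz: "B \<noteq> 0\<^sub>m 1 (q ! k)"
  note facts = tucker_decomp_facts[OF T]
  let ?ps = "map (\<lambda>k. (k, U k)) (modes n)"
  let ?N = "prod_list (delete_at k n)"
  have X: "X = mode_prods q G ?ps" using T by (simp add: tucker_decomp_def)
  have comp: "compatible q ?ps" using facts by (auto simp: compatible_map)
  have size: "result_size q ?ps = n" by (rule result_size_eqI[OF comp]) (use facts in \<open>auto simp: image_image\<close>)
  note Uk = facts(2)[OF k] and UU = facts(3)[OF k]
  have St: "U k \<in> stiefel (q ! k) (n ! k)" using Uk UU by (simp add: stiefel_def)
  have mem: "(k, U k) \<in> set ?ps" using k by simp
  have Xk: "unfolding_mat n k X \<in> carrier_mat (n ! k) ?N" by (rule unfolding_mat_carrier)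
  have UT: "transpose_mat (U k) \<in> carrier_mat (q ! k) (n ! k)" using Uk by simp
  define Z where "Z = transpose_mat (U k) * unfolding_mat n k X"
  have Z: "Z \<in> carrier_mat (q ! k) ?N" unfolding Z_def by (rule mult_carrier_mat[OF UT Xk])
  have "mode_prod (result_size q ?ps) k (orth_proj (U k)) (mode_prods q G ?ps) = mode_prods q G ?ps"
    by (rule mode_prod_mode_prods_absorb[OF comp mem]) (simp_all add: orth_proj_stiefel_mult[OF St])
  then have "mode_prod n k (orth_proj (U k)) X = X" by (simp only: size X)
  then have "unfolding_mat n k X = orth_proj (U k) * unfolding_mat n k X"
    by (rule unfolding_mat_invariant) (use k Uk in auto)
  also have "\<dots> = U k * Z"
    unfolding orth_proj_def Z_def by (rule assoc_mult_mat[OF Uk UT Xk])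
  finally have XUZ: "unfolding_mat n k X = U k * Z" .
  \<comment> \<open>\<open>B' * U k = B\<close>, so B' acts on X in mode k as B acts on the core, that is, as zero.\<close>
  define B' where "B' = B * transpose_mat (U k)"
  have B': "B' \<in> carrier_mat 1 (n ! k)" unfolding B'_def by (rule mult_carrier_mat[OF B UT])
  have B'U: "B' * U k = B"
    unfolding B'_def using assoc_mult_mat[OF B UT Uk] UU B by simp
  have "mode_prod n k B' X
      = mode_prods q G (map (\<lambda>(j, C). (j, if j = k then B' * C else C)) ?ps)"
    using mode_prod_mode_prods_same[OF comp mem, of B' G] B' Uk by (simp only: size X) auto
  also have "map (\<lambda>(j, C). (j, if j = k then B' * C else C)) ?ps
      = map (\<lambda>j. (j, if j = k then B else U j)) (modes n)"
    by (auto simp: B'U)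
  also have "mode_prods q G \<dots> = 0"
  proof (rule mode_prods_eq_0)
    show "compatible q (map (\<lambda>j. (j, if j = k then B else U j)) (modes n))"
      using facts B by (auto simp: compatible_map)
    show "(k, B) \<in> set (map (\<lambda>j. (j, if j = k then B else U j)) (modes n))" using k by force
    show "B * unfolding_mat q k G = 0\<^sub>m (dim_row B) (prod_list (delete_at k q))" using BG B by simp
  qed
  finally have "B' * unfolding_mat n k X = unfolding_mat (n[k := 1]) k 0"
    using unfolding_mat_mode_prod[OF k, of B' X] B' by simp
  also have "\<dots> = 0\<^sub>m 1 ?N"
    using k by (intro eq_matI) (auto simp: unfolding_mat_def zero_tensor.rep_eq)
  finally have "B * Z = 0\<^sub>m 1 ?N"
    unfolding Z_def B'_def using assoc_mult_mat[OF B UT Xk] by simp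
  then have "mat_rank (U k * Z) < q ! k" by (rule mat_rank_mult_less[OF Uk Z B _ nz])
  then show False using facts(4)[OF k] XUZ by simp
qed

lemma is_pinv_core_unfolding:
  assumes "tucker_decomp n X q G U" "k < length n"
  shows "is_pinv (unfolding_mat q k G) (pinv (unfolding_mat q k G))"
  by (rule is_pinv_pinv[OF unfolding_mat_carrier]) (rule tucker_core_row_independent[OF assms])

section \<open>The approximate projection as an orthogonal projection\<close>

text \<open>
  The approximate projection is a sum \<open>T0 + T 0 + \<dots> + T (d - 1)\<close>. Each term is the image of A under
  an orthogonal projection: T0 visibly so, and \<open>T k\<close> because \<open>G\<^sup>\<dagger> * G\<close> is the orthogonal projection onto the
  row space of the core unfolding G in mode k, and the \<open>U j\<close> are isometries. The ranges are pairwise orthogonal,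
  since in mode k the columns of \<open>T k\<close> are orthogonal to those of \<open>[U k, U1 k]\<close>, whereas the columns of all
  other terms lie in their span. So the whole map is an orthogonal projection.
\<close>

lemma inner_approx_proj:
  assumes T: "tucker_decomp n X q G U"
    and U1: "\<And>k. k < length n \<Longrightarrow> U1 k \<in> stiefel (s k) (n ! k)"
    and UU1: "\<And>k. k < length n \<Longrightarrow> transpose_mat (U k) * U1 k = 0\<^sub>m (q ! k) (s k)"
    and n: "n \<noteq> []"
  shows "inner A (approx_proj n q G U U1 A) = inner (approx_proj n q G U U1 A) (approx_proj n q G U U1 A)"
proof -
  define P where "P = (\<lambda>k. orth_proj (hcat (U k) (U1 k)))"
  define R where "R = (\<lambda>k. orth_proj_compl (hcat (U k) (U1 k)))"
  define C where "C = (\<lambda>k. mode_prods n A (map (\<lambda>j. (j, transpose_mat (U j))) (other_modes n k)))"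
  define M where "M = (\<lambda>k. R k * unfolding_mat (q[k := n ! k]) k (C k) * pinv (unfolding_mat q k G))"
  define qs where "qs = (\<lambda>k. map (\<lambda>j. (j, U j)) (other_modes n k))"
  define ps where "ps = map (\<lambda>k. (k, P k)) (modes n)"
  define T0 where "T0 = mode_prods n A ps"
  define T where "T = (\<lambda>k. mode_prods q G ((k, M k) # qs k))"
  have g: "approx_proj n q G U U1 A = T0 + (\<Sum>k<length n. T k)"
    by (simp add: approx_proj_def Let_def T0_def T_def P_def R_def M_def C_def ps_def qs_def)
  note facts = tucker_decomp_facts[OF assms(1)]
  have St: "U k \<in> stiefel (q ! k) (n ! k)" if "k < length n" for k
    using facts(2,3)[OF that] by (simp add: stiefel_def)
  have Sc: "hcat (U k) (U1 k) \<in> carrier_mat (n ! k) (q ! k + s k)" if "k < length n" for k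
    using hcat_carrier[of "U k"] facts(2)[OF that] U1[OF that] by (simp add: stiefel_def)
  have Pc: "P k \<in> carrier_mat (n ! k) (n ! k)" if "k < length n" for k
    using Sc[OF that] by (simp add: P_def orth_proj_def)
  have Pd: "dim_row (P k) = n ! k" "dim_col (P k) = n ! k" if "k < length n" for k
    using Pc[OF that] by auto
  have PU: "P k * U k = U k" and PP: "P k * P k = P k" if "k < length n" for k
    using orth_proj_hcat_facts[OF St[OF that] U1[OF that] UU1[OF that]] by (simp_all add: P_def)
  have PT: "transpose_mat (P k) = P k" for k by (simp add: P_def)
  have Rc: "R k \<in> carrier_mat (n ! k) (n ! k)" "transpose_mat (R k) = R k" "R k * R k = R k"
      "P k * R k = 0\<^sub>m (n ! k) (n ! k)" if "k < length n" for k
    using orth_proj_compl_facts[OF Sc[OF that] PP[OF that, unfolded P_def]] by (simp_all add: R_def P_def)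

  have comp0: "compatible n ps" using Pd by (auto simp: ps_def compatible_map)
  have size0: "result_size n ps = n" by (rule result_size_eqI[OF comp0]) (use Pd in \<open>auto simp: ps_def\<close>)
  have T0_in: "T0 \<in> tensors n"
    using mode_prods_in_tensors[of A n ps] size0 n by (simp add: T0_def ps_def)
  have pinv: "is_pinv (unfolding_mat q k G) (pinv (unfolding_mat q k G))" if "k < length n" for k
    by (rule is_pinv_core_unfolding[OF assms(1) that])
  let ?m = "\<lambda>k. prod_list (delete_at k q)"
  have Gk: "unfolding_mat q k G \<in> carrier_mat (q ! k) (?m k)" for k
    by (rule unfolding_mat_carrier)
  have Gp: "pinv (unfolding_mat q k G) \<in> carrier_mat (?m k) (q ! k)" if "k < length n" for k
    using pinv[OF that] Gk[of k] by (auto simp: is_pinv_def)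
  have Ck: "unfolding_mat (q[k := n ! k]) k (C k) \<in> carrier_mat (n ! k) (?m k)" if "k < length n" for k
    using unfolding_mat_carrier[of "q[k := n ! k]" k "C k"] that facts(1) by simp
  have Mc: "M k \<in> carrier_mat (n ! k) (q ! k)" if "k < length n" for k
    unfolding M_def by (rule mult_carrier_mat[OF mult_carrier_mat[OF Rc(1) Ck] Gp]) (use that in auto)
  have comp: "compatible q ((k, M k) # qs k)" "compatible (q[k := n ! k]) (qs k)" if "k < length n" for k
    using Mc[OF that] facts that
    by (auto simp: compatible_Cons compatible_map qs_def)
  have size: "result_size (q[k := n ! k]) (qs k) = n" if "k < length n" for k
    by (rule result_size_eqI[OF comp(2)[OF that]]) (use facts that in \<open>auto simp: qs_def nth_list_update image_image\<close>)
  have size': "result_size q ((k, M k) # qs k) = n" if "k < length n" for k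
    using size[OF that] Mc[OF that] by simp

  \<comment> \<open>The factors \<open>U j\<close>, \<open>j \<noteq> k\<close>, are isometries, so they can be moved to A or dropped, which turns
    both inner products into inner products with W; then the unfolding of W in mode k is that of
    \<open>C k\<close> compressed by orthogonal projections from both sides.\<close>
  have diag: "inner A (T k) = inner (T k) (T k)" if k: "k < length n" for k
  proof -
    let ?q = "q[k := n ! k]"
    define W where "W = mode_prod q k (M k) G"
    have kq: "k < length q" "k < length ?q" using k facts(1) by auto
    have W_in: "W \<in> tensors ?q"
      using mode_prod_in_tensors[of q k "M k" G] Mc[OF k] by (simp add: W_def)
    have TW: "T k = mode_prods ?q W (qs k)" using Mc[OF k] by (simp add: T_def W_def)
    have tr: "map (\<lambda>(j, B). (j, transpose_mat B)) (qs k)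
        = map (\<lambda>j. (j, transpose_mat (U j))) (other_modes n k)" by (simp add: qs_def)
    have "inner (T k) A = inner W (C k)"
      unfolding TW mode_prods_adjoint[OF comp(2)[OF k]] size[OF k] tr C_def ..
    moreover have "inner (T k) (T k) = inner W W"
      unfolding TW by (rule mode_prods_isometry[OF comp(2)[OF k] W_in]) (use facts in \<open>auto simp: qs_def\<close>)
    moreover have "inner W W = inner W (C k)"
    proof -
      define H where "H = pinv (unfolding_mat q k G) * unfolding_mat q k G"
      let ?Ck = "unfolding_mat ?q k (C k)"
      have H: "H \<in> carrier_mat (?m k) (?m k)" unfolding H_def by (rule mult_carrier_mat[OF Gp[OF k] Gk])
      have HT: "transpose_mat H = H" using pinv[OF k] by (simp add: is_pinv_def H_def)
      have "H * H = pinv (unfolding_mat q k G) * unfolding_mat q k G * pinv (unfolding_mat q k G) * unfolding_mat q k G"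
        unfolding H_def using assoc_mult_mat[OF H[unfolded H_def] Gp[OF k] Gk] by simp
      then have HH: "H * H = H" using pinv[OF k] by (simp add: is_pinv_def H_def)
      have "unfolding_mat ?q k W = M k * unfolding_mat q k G"
        using unfolding_mat_mode_prod[OF kq(1), of "M k" G] Mc[OF k] by (simp add: W_def)
      also have "\<dots> = R k * ?Ck * H"
        unfolding M_def H_def
        by (rule assoc_mult_mat[OF mult_carrier_mat[OF Rc(1)[OF k] Ck[OF k]] Gp[OF k] Gk])
      finally have Wk: "unfolding_mat ?q k W = R k * ?Ck * H" .
      have "inner W W = mat_inner (R k * ?Ck * H) (R k * ?Ck * H)"
        using inner_eq_mat_inner[OF kq(2) W_in, of W] by (simp only: Wk)
      also have "\<dots> = mat_inner ?Ck (R k * ?Ck * H)"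
        by (rule mat_inner_sandwich[OF Rc(1-3)[OF k] H HT HH Ck[OF k]])
      also have "\<dots> = mat_inner (R k * ?Ck * H) ?Ck"
        by (rule mat_inner_commute[OF Ck[OF k] mult_carrier_mat[OF mult_carrier_mat[OF Rc(1)[OF k] Ck[OF k]] H]])
      also have "\<dots> = inner W (C k)"
        using inner_eq_mat_inner[OF kq(2) W_in, of "C k"] by (simp only: Wk)
      finally show ?thesis .
    qed
    ultimately show ?thesis by (simp add: inner_commute)
  qed

  \<comment> \<open>The projection \<open>P k\<close> in mode k fixes every term except \<open>T k\<close>, which it annihilates.
    Being self-adjoint, it forces these to be orthogonal.\<close>
  have inv0: "mode_prod n k (P k) T0 = T0" if k: "k < length n" for k
    using mode_prod_mode_prods_absorb[OF comp0, of k "P k" "P k" A] PP[OF k] Pc[OF k] k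
    by (simp add: size0 T0_def) (simp add: ps_def)
  have inv: "mode_prod n k (P k) (T l) = T l" if k: "k < length n" and l: "l < length n" "k \<noteq> l" for k l
    using mode_prod_mode_prods_absorb[OF comp(1)[OF l(1)], of k "U k" "P k" G] PU[OF k] Pc[OF k] k l
      facts(2)[OF k]
    unfolding size'[OF l(1)] T_def by (simp add: qs_def)
  have kill: "mode_prod n k (P k) (T k) = 0" if k: "k < length n" for k
  proof -
    have RCG: "R k * unfolding_mat (q[k := n ! k]) k (C k) \<in> carrier_mat (n ! k) (?m k)"
      by (rule mult_carrier_mat[OF Rc(1)[OF k] Ck[OF k]])
    have "P k * M k = P k * (R k * unfolding_mat (q[k := n ! k]) k (C k)) * pinv (unfolding_mat q k G)"
      unfolding M_def by (rule assoc_mult_mat[OF Pc[OF k] RCG Gp[OF k], symmetric])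
    also have "P k * (R k * unfolding_mat (q[k := n ! k]) k (C k))
        = P k * R k * unfolding_mat (q[k := n ! k]) k (C k)"
      by (rule assoc_mult_mat[OF Pc[OF k] Rc(1)[OF k] Ck[OF k], symmetric])
    finally have PM: "P k * M k = 0\<^sub>m (n ! k) (q ! k)"
      using Rc(4)[OF k] left_mult_zero_mat[OF Ck[OF k], of "n ! k"] left_mult_zero_mat[OF Gp[OF k], of "n ! k"]
      by simp
    let ?qs = "map (\<lambda>(j, B). (j, if j = k then P k * B else B)) ((k, M k) # qs k)"
    have "mode_prod n k (P k) (T k) = mode_prods q G ?qs"
      using mode_prod_mode_prods_same[OF comp(1)[OF k], of k "M k" "P k" G] Pc[OF k] Mc[OF k]
      unfolding size'[OF k] T_def by simp
    also have "\<dots> = 0"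
    proof (rule mode_prods_eq_0)
      show "compatible q ?qs"
        using facts k PM by (auto simp: compatible_Cons compatible_def qs_def comp_def)
      show "(k, P k * M k) \<in> set ?qs" by simp
      show "P k * M k * unfolding_mat q k G = 0\<^sub>m (dim_row (P k * M k)) (?m k)"
        unfolding PM using left_mult_zero_mat[OF Gk] by simp
    qed
    finally show ?thesis .
  qed
  have move: "inner (mode_prod n k (P k) V) W = inner V (mode_prod n k (P k) W)" if k: "k < length n" for k V W
    using mode_prod_adjoint[OF k, of "P k" V W] Pc[OF k] by (simp add: PT)
  have orth0: "inner T0 (T k) = 0" if k: "k < length n" for k
    using move[OF k, of T0 "T k"] inv0[OF k] kill[OF k] by simp
  have orth: "inner (T k) (T l) = 0" if "k < length n" "l < length n" "k \<noteq> l" for k l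
    using move[OF that(1), of "T k" "T l"] inv[OF that] kill[OF that(1)] by simp
  \<comment> \<open>The first term is an orthogonal projection of A.\<close>
  have diag0: "inner A T0 = inner T0 T0"
  proof -
    have tr: "map (\<lambda>(j, B). (j, transpose_mat B)) ps = ps" by (simp add: ps_def PT)
    have "mode_prods n T0 ps = T0"
    proof -
      have "mode_prods n T0 (map (\<lambda>k. (k, P k)) ks) = T0" if "set ks \<subseteq> {..<length n}" for ks
        using that
      proof (induction ks)
        case (Cons k ks)
        then have "n[k := dim_row (P k)] = n" using Pc[of k] by simp
        then show ?case using Cons inv0[of k] by simp
      qed simp
      from this[of "modes n"] show ?thesis unfolding ps_def by (simp add: atLeast0LessThan)
    qed
    then have "inner T0 T0 = inner A T0"
      using mode_prods_adjoint[OF comp0, of A T0] unfolding size0 tr T0_def by simp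
    then show ?thesis by simp
  qed
  let ?L = "{..<length n}"
  have col: "inner (T k) (\<Sum>l<length n. T l) = inner (T k) (T k)" if k: "k < length n" for k
  proof -
    have "inner (T k) (\<Sum>l<length n. T l) = (\<Sum>l\<in>?L. inner (T k) (T l))" by (rule inner_sum_right)
    also have "\<dots> = (\<Sum>l\<in>?L. if l = k then inner (T k) (T k) else 0)"
      using k orth by (intro sum.cong) auto
    finally show ?thesis using k by simp
  qed
  define V where "V = (\<Sum>l<length n. T l)"
  have "inner T0 V = (\<Sum>l<length n. inner T0 (T l))" unfolding V_def by (rule inner_sum_right)
  also have "\<dots> = 0" by (rule sum.neutral) (simp add: orth0)
  finally have T0V: "inner T0 V = 0" .
  have "inner V V = (\<Sum>k<length n. inner (T k) V)"
    by (subst (1) V_def) (rule inner_sum_left)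
  also have "\<dots> = (\<Sum>k<length n. inner A (T k))"
    by (rule sum.cong) (simp_all add: V_def col diag)
  also have "\<dots> = inner A V" unfolding V_def by (rule inner_sum_right[symmetric])
  finally have VV: "inner V V = inner A V" .
  have "inner (T0 + V) (T0 + V) = inner T0 T0 + inner T0 V + (inner T0 V + inner V V)"
    by (simp only: inner_add_left inner_add_right inner_commute[of V T0])
  also have "\<dots> = inner A (T0 + V)" using T0V VV diag0 by (simp add: inner_add_right)
  finally show ?thesis unfolding g V_def by simp
qed

lemma is_approx_proj_inner:
  assumes "is_approx_proj n r X A g" "n \<noteq> []"
  shows "inner A g = (norm g)\<^sup>2"
proof -
  obtain q G U U1 where "tucker_decomp n X q G U"
    and "\<And>k. k < length n \<Longrightarrow> U1 k \<in> stiefel (r ! k - q ! k) (n ! k)"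
    and "\<And>k. k < length n \<Longrightarrow> transpose_mat (U k) * U1 k = 0\<^sub>m (q ! k) (r ! k - q ! k)"
    and "g = approx_proj n q G U U1 A"
    using assms(1) unfolding is_approx_proj_def by blast
  from inner_approx_proj[OF this(1-3) assms(2), of A] this(4) show ?thesis
    by (simp add: power2_norm_eq_inner)
qed

section \<open>Sufficient decrease\<close>

text \<open>
  Dividing the angle condition by \<open>norm g\<close> turns it into \<open>\<omega> * norm p \<le> norm g\<close>, which is then squared.
  For \<open>g = 0\<close> the bound holds because p vanishes as well.
\<close>

lemma angle_condition_lower_bound:
  assumes "angle_condition \<omega> A p g" "inner A g = (norm g)\<^sup>2" "0 < \<omega>"
  shows "\<omega>\<^sup>2 * (norm p)\<^sup>2 \<le> inner A g"
proof (cases "g = 0")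
  case False
  then have "\<omega> * norm p * norm g \<le> norm g * norm g" "0 < norm g"
    using assms by (auto simp: angle_condition_def power2_eq_square)
  then have "\<omega> * norm p \<le> norm g" by (simp only: mult_le_cancel_right_pos)
  then have "(\<omega> * norm p)\<^sup>2 \<le> (norm g)\<^sup>2" using assms(3) by (intro power_mono) auto
  then show ?thesis using assms(2) by (simp add: power_mult_distrib)
qed (use assms in \<open>auto simp: angle_condition_def\<close>)

text \<open>
  The decreases telescope to at most \<open>v 0 - b\<close>. So the squares of p are summable, and at most
  \<open>(v 0 - b) / (c * \<epsilon>\<^sup>2)\<close> of the values of p can be at least \<open>\<epsilon>\<close>.
\<close>

lemma
  fixes v p :: "nat \<Rightarrow> real"
  assumes c: "0 < c" and dec: "\<And>t. c * (p t)\<^sup>2 \<le> v t - v (Suc t)" and low: "\<And>t. b \<le> v t"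
    and p: "\<And>t. 0 \<le> p t"
  shows sufficient_decrease_tendsto: "p \<longlonglongrightarrow> 0"
    and sufficient_decrease_count:
      "\<epsilon> > 0 \<Longrightarrow> \<exists>t. int t \<le> \<lceil>(v 0 - b) / (c * \<epsilon>\<^sup>2)\<rceil> \<and> p t < \<epsilon>"
proof -
  have tele: "(\<Sum>t<N. c * (p t)\<^sup>2) \<le> v 0 - v N" for N
  proof (induction N)
    case (Suc N)
    then show ?case using dec[of N] by simp
  qed simp
  have bound: "(\<Sum>t<N. c * (p t)\<^sup>2) \<le> v 0 - b" for N
    using tele[of N] low[of N] by simp
  have "summable (\<lambda>t. c * (p t)\<^sup>2)"
    by (rule bounded_imp_summable[where B = "v 0 - b"])
      (use c bound[of "Suc _"] in \<open>auto simp: lessThan_Suc_atMost\<close>)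
  then have "(\<lambda>t. c * (p t)\<^sup>2) \<longlonglongrightarrow> 0" by (rule summable_LIMSEQ_zero)
  then have "(\<lambda>t. sqrt (inverse c * (c * (p t)\<^sup>2))) \<longlonglongrightarrow> sqrt (inverse c * 0)"
    by (intro tendsto_intros)
  then show "p \<longlonglongrightarrow> 0" using c p by (simp add: mult.assoc[symmetric])
  show "\<exists>t. int t \<le> \<lceil>(v 0 - b) / (c * \<epsilon>\<^sup>2)\<rceil> \<and> p t < \<epsilon>" if e: "\<epsilon> > 0"
  proof (rule ccontr)
    let ?K = "(v 0 - b) / (c * \<epsilon>\<^sup>2)"
    assume neg: "\<not> ?thesis"
    \<comment> \<open>The \<open>N + 1\<close> iterates \<open>0, \<dots>, N\<close> would all violate the tolerance, which costs more
      than the total decrease \<open>v 0 - b\<close>.\<close>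
    define N where "N = nat \<lceil>?K\<rceil>"
    have "0 \<le> ?K" using low[of 0] c e by simp
    then have N: "int N = \<lceil>?K\<rceil>" by (simp add: N_def)
    have "real (Suc N) * (c * \<epsilon>\<^sup>2) = (\<Sum>t<Suc N. c * \<epsilon>\<^sup>2)" by simp
    also have "\<dots> \<le> (\<Sum>t<Suc N. c * (p t)\<^sup>2)"
    proof (rule sum_mono)
      fix t assume "t \<in> {..<Suc N}"
      then have "int t \<le> \<lceil>?K\<rceil>" using N by simp
      then have "\<epsilon> \<le> p t" using neg by force
      then show "c * \<epsilon>\<^sup>2 \<le> c * (p t)\<^sup>2" using e c by (intro mult_left_mono power_mono) auto
    qed
    also have "\<dots> \<le> v 0 - b" by (rule bound)
    finally have "real (Suc N) \<le> ?K" using c e by (simp add: pos_le_divide_eq)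
    moreover have "?K \<le> real N" using N by linarith
    ultimately show False by simp
  qed
qed

section \<open>Convergence of the GRAP method\<close>

theorem theorem2:
  fixes n r :: "nat list" and f :: "tensor \<Rightarrow> real" and X :: "nat \<Rightarrow> tensor"
    and \<omega> \<rho> a smin fstar :: real
  assumes "n \<noteq> []" and "length r = length n"
    and "\<forall>k<length n. 1 \<le> r ! k \<and> r ! k \<le> n ! k"
    and "smooth_on (tensors n) f"
    and "0 < \<omega>" "\<omega> \<le> 1" and "0 < \<rho>" "\<rho> < 1" and "0 < a" "a < 1" and "0 < smin"
    and "grap_sequence n r f \<omega> \<rho> a smin X"
    and "\<forall>Y\<in>tensors n. fstar \<le> f Y"
  shows "((\<lambda>t. norm (metric_proj (tangent_cone (tucker_variety n r) (X t))
                                (- grad (tensors n) f (X t)))) \<longlonglongrightarrow> 0)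
    \<and> (\<forall>\<epsilon>>0. \<exists>t. int t \<le> \<lceil>(f (X 0) - fstar) / (smin * a * \<omega>\<^sup>2 * \<epsilon>\<^sup>2)\<rceil>
           \<and> X t \<in> tucker_variety n r
           \<and> norm (metric_proj (tangent_cone (tucker_variety n r) (X t))
                                (- grad (tensors n) f (X t))) < \<epsilon>)
    \<and> (0 \<le> fstar \<longrightarrow>
         (\<forall>\<epsilon>>0. \<exists>t. int t \<le> \<lceil>f (X 0) / (smin * a * \<omega>\<^sup>2 * \<epsilon>\<^sup>2)\<rceil>
           \<and> X t \<in> tucker_variety n r
           \<and> norm (metric_proj (tangent_cone (tucker_variety n r) (X t))
                                (- grad (tensors n) f (X t))) < \<epsilon>))"
proof -
  define A where "A = (\<lambda>t. - grad (tensors n) f (X t))"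
  define p where "p = (\<lambda>t. norm (metric_proj (tangent_cone (tucker_variety n r) (X t)) (A t)))"
  let ?c = "smin * a * \<omega>\<^sup>2"
  have c: "0 < ?c" using assms by simp
  have step: "X (Suc t) \<in> tucker_variety n r \<and> ?c * (p t)\<^sup>2 \<le> f (X t) - f (X (Suc t))" for t
  proof -
    have "grap_step n r f \<omega> \<rho> a smin (X t) (X (Suc t))"
      using assms(12) by (simp add: grap_sequence_def)
    then obtain g s0 l Y where g: "is_approx_proj n r (X t) (A t) g"
      and angle: "angle_condition \<omega> (A t) (metric_proj (tangent_cone (tucker_variety n r) (X t)) (A t)) g"
      and s: "smin < \<rho> ^ l * s0"
      and Y: "is_hosvd_proj n r (X t + (\<rho> ^ l * s0) *\<^sub>R g) (Y l)"
      and armijo: "\<rho> ^ l * s0 * a * inner (A t) g \<le> f (X t) - f (Y l)"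
      and X': "X (Suc t) = Y l"
      unfolding grap_step_def Let_def A_def by blast
    have low: "\<omega>\<^sup>2 * (p t)\<^sup>2 \<le> inner (A t) g"
      unfolding p_def by (rule angle_condition_lower_bound[OF angle is_approx_proj_inner[OF g assms(1)] assms(5)])
    have "?c * (p t)\<^sup>2 = smin * a * (\<omega>\<^sup>2 * (p t)\<^sup>2)" by simp
    also have "\<dots> \<le> (\<rho> ^ l * s0) * a * inner (A t) g"
      using s low assms(9,11) by (intro mult_mono) auto
    finally have "?c * (p t)\<^sup>2 \<le> f (X t) - f (X (Suc t))" using armijo X' by simp
    moreover have "X (Suc t) \<in> tucker_variety n r"
      unfolding X' by (rule hosvd_proj_in_tucker_variety[OF assms(1,2) _ Y]) (use assms(3) in auto)
    ultimately show ?thesis by simp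
  qed
  have variety: "X t \<in> tucker_variety n r" for t
    using assms(12) step by (cases t) (auto simp: grap_sequence_def)
  have low: "fstar \<le> f (X t)" for t
    using variety[of t] assms(13) by (auto simp: tucker_variety_def)
  have dec: "?c * (p t)\<^sup>2 \<le> f (X t) - f (X (Suc t))" for t using step by blast
  have p: "0 \<le> p t" for t by (simp add: p_def)
  note count = sufficient_decrease_count[where v = "\<lambda>t. f (X t)", OF c dec _ p]
  have lim: "p \<longlonglongrightarrow> 0"
    by (rule sufficient_decrease_tendsto[where v = "\<lambda>t. f (X t)", OF c dec low p])
  have p_eq: "norm (metric_proj (tangent_cone (tucker_variety n r) (X t)) (- grad (tensors n) f (X t))) = p t"
    for t by (simp add: p_def A_def)
  show ?thesis
    unfolding p_eq
  proof (intro conjI allI impI)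
    show "p \<longlonglongrightarrow> 0" by (rule lim)
    show "\<exists>t. int t \<le> \<lceil>(f (X 0) - fstar) / (?c * \<epsilon>\<^sup>2)\<rceil> \<and> X t \<in> tucker_variety n r \<and> p t < \<epsilon>"
      if "\<epsilon> > 0" for \<epsilon>
      using count[OF low that] variety by blast
    show "\<exists>t. int t \<le> \<lceil>f (X 0) / (?c * \<epsilon>\<^sup>2)\<rceil> \<and> X t \<in> tucker_variety n r \<and> p t < \<epsilon>"
      if "0 \<le> fstar" "\<epsilon> > 0" for \<epsilon>
    proof -
      \<comment> \<open>Here 0 itself is a lower bound of f along the iterates.\<close>
      have "0 \<le> f (X t)" for t using low[of t] that(1) by simp
      from count[OF this that(2)] show ?thesis using variety by auto
    qed
  qed
qed

end
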